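(* Let $G$ be a group whose center is finite and whose automorphism group $\mathrm{Aut}(G)$ is acylindrically hyperbolic. Let $H$ be a group and $\varphi: H\to \mathrm{Aut}(G)$ a morphism. Then the semidirect product $G\rtimes_\varphi H$ is acylindrically hyperbolic if and only if $$K:=\ker\left(H\overset{\varphi}{\to}\mathrm{Aut}(G)\to\mathrm{Out}(G)\right)$$ is a finite subgroup of $H$.
   Context: $\mathrm{Out}(G)=\mathrm{Aut}(G)/\mathrm{Inn}(G)$, and $\mathrm{Aut}(G)\to\mathrm{Out}(G)$ is the quotient map. An isometric action of a group $\Gamma$ on a metric space $(X,d)$ is acylindrical if for every $\epsilon>0$ there exist $R,N>0$ such that for all $x,y\in X$ with $d(x,y)\ge R$, at most $N$ elements $\gamma\in\Gamma$ satisfy $d(x,\gamma x)\le\epsilon$ and $d(y,\gamma y)\le\epsilon$. A group is acylindrically hyperbolic if it admits a non-elementary acylindrical isometric action on a Gromov-hyperbolic geodesic metric space (non-elementary: the limit set in the Gromov boundary is infinite). *)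

theory Defs
  imports "HOL-Algebra.Algebra" "HOL-Analysis.Analysis"
begin

section \<open>Groups\<close>

definition group_center :: "('a, 'm) monoid_scheme \<Rightarrow> 'a set" where
  "group_center G =
     {z \<in> carrier G. \<forall>x \<in> carrier G. z \<otimes>\<^bsub>G\<^esub> x = x \<otimes>\<^bsub>G\<^esub> z}"

text \<open>Restricted to the carrier because the elements of \<^const>\<open>AutoGroup\<close> are extensional functions.\<close>

definition inner_aut :: "('a, 'm) monoid_scheme \<Rightarrow> 'a \<Rightarrow> 'a \<Rightarrow> 'a" where
  "inner_aut G g = (\<lambda>x \<in> carrier G. g \<otimes>\<^bsub>G\<^esub> x \<otimes>\<^bsub>G\<^esub> inv\<^bsub>G\<^esub> g)"

definition Inn :: "('a, 'm) monoid_scheme \<Rightarrow> ('a \<Rightarrow> 'a) set" where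
  "Inn G = inner_aut G ` carrier G"

definition OutGroup :: "('a, 'm) monoid_scheme \<Rightarrow> ('a \<Rightarrow> 'a) set monoid" where
  "OutGroup G = AutoGroup G Mod Inn G"

definition to_Out :: "('a, 'm) monoid_scheme \<Rightarrow> ('a \<Rightarrow> 'a) \<Rightarrow> ('a \<Rightarrow> 'a) set" where
  "to_Out G \<alpha> = Inn G #>\<^bsub>AutoGroup G\<^esub> \<alpha>"

definition semidirect_product ::
  "('a, 'm) monoid_scheme \<Rightarrow> ('b, 'n) monoid_scheme \<Rightarrow> ('b \<Rightarrow> 'a \<Rightarrow> 'a) \<Rightarrow> ('a \<times> 'b) monoid" where
  "semidirect_product G H \<phi> =
     \<lparr>carrier = carrier G \<times> carrier H,
      monoid.mult = (\<lambda>(g, h) (g', h'). (g \<otimes>\<^bsub>G\<^esub> \<phi> h g', h \<otimes>\<^bsub>H\<^esub> h')),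
      one = (\<one>\<^bsub>G\<^esub>, \<one>\<^bsub>H\<^esub>)\<rparr>"


section \<open>Gromov-hyperbolic geodesic spaces\<close>

definition geodesic_space :: "'x set \<Rightarrow> ('x \<Rightarrow> 'x \<Rightarrow> real) \<Rightarrow> bool" where
  "geodesic_space M d \<longleftrightarrow>
     (\<forall>x \<in> M. \<forall>y \<in> M. \<exists>\<gamma>. \<gamma> ` {0..d x y} \<subseteq> M \<and> \<gamma> 0 = x \<and> \<gamma> (d x y) = y \<and>
        (\<forall>s \<in> {0..d x y}. \<forall>t \<in> {0..d x y}. d (\<gamma> s) (\<gamma> t) = \<bar>s - t\<bar>))"

definition gromov_product :: "('x \<Rightarrow> 'x \<Rightarrow> real) \<Rightarrow> 'x \<Rightarrow> 'x \<Rightarrow> 'x \<Rightarrow> real" where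
  "gromov_product d p x y = (d x p + d y p - d x y) / 2"

definition gromov_hyperbolic :: "'x set \<Rightarrow> ('x \<Rightarrow> 'x \<Rightarrow> real) \<Rightarrow> bool" where
  "gromov_hyperbolic M d \<longleftrightarrow>
     (\<exists>\<delta> \<ge> 0. \<forall>p \<in> M. \<forall>x \<in> M. \<forall>y \<in> M. \<forall>z \<in> M.
        gromov_product d p x z \<ge> min (gromov_product d p x y) (gromov_product d p y z) - \<delta>)"

text \<open>
  The spaces are not assumed to be proper, so the boundary is the sequential one: classes of
  sequences \<open>s\<close> with \<open>(s\<^sub>i|s\<^sub>j) \<longlonglongrightarrow> \<infinity>\<close> as \<open>i, j \<longlonglongrightarrow> \<infinity>\<close>, where \<open>s\<close> and \<open>t\<close> are identified if
  \<open>(s\<^sub>i|t\<^sub>j) \<longlonglongrightarrow> \<infinity>\<close>. Changing the base point changes Gromov products by a bounded amount, so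
  quantifying over all base points only serves to avoid fixing one.
\<close>

definition gromov_products_diverge ::
  "'x set \<Rightarrow> ('x \<Rightarrow> 'x \<Rightarrow> real) \<Rightarrow> (nat \<Rightarrow> 'x) \<Rightarrow> (nat \<Rightarrow> 'x) \<Rightarrow> bool" where
  "gromov_products_diverge M d s t \<longleftrightarrow>
     (\<forall>p \<in> M. filterlim (\<lambda>(i, j). gromov_product d p (s i) (t j)) at_top
        (sequentially \<times>\<^sub>F sequentially))"

definition gromov_sequences :: "'x set \<Rightarrow> ('x \<Rightarrow> 'x \<Rightarrow> real) \<Rightarrow> (nat \<Rightarrow> 'x) set" where
  "gromov_sequences M d = {s. range s \<subseteq> M \<and> gromov_products_diverge M d s s}"

definition gromov_boundary :: "'x set \<Rightarrow> ('x \<Rightarrow> 'x \<Rightarrow> real) \<Rightarrow> (nat \<Rightarrow> 'x) set set" where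
  "gromov_boundary M d =
     gromov_sequences M d //
       {(s, t) \<in> gromov_sequences M d \<times> gromov_sequences M d. gromov_products_diverge M d s t}"


section \<open>Group actions\<close>

definition isometric_action ::
  "('g, 'm) monoid_scheme \<Rightarrow> 'x set \<Rightarrow> ('x \<Rightarrow> 'x \<Rightarrow> real) \<Rightarrow> ('g \<Rightarrow> 'x \<Rightarrow> 'x) \<Rightarrow> bool" where
  "isometric_action \<Gamma> M d \<rho> \<longleftrightarrow>
     group_action \<Gamma> M \<rho> \<and>
     (\<forall>g \<in> carrier \<Gamma>. \<forall>x \<in> M. \<forall>y \<in> M. d (\<rho> g x) (\<rho> g y) = d x y)"

definition acylindrical_action ::
  "('g, 'm) monoid_scheme \<Rightarrow> 'x set \<Rightarrow> ('x \<Rightarrow> 'x \<Rightarrow> real) \<Rightarrow> ('g \<Rightarrow> 'x \<Rightarrow> 'x) \<Rightarrow> bool" where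
  "acylindrical_action \<Gamma> M d \<rho> \<longleftrightarrow>
     isometric_action \<Gamma> M d \<rho> \<and>
     (\<forall>\<epsilon> > 0. \<exists>(R::real) > 0. \<exists>(N::nat) > 0. \<forall>x \<in> M. \<forall>y \<in> M. d x y \<ge> R \<longrightarrow>
        finite {g \<in> carrier \<Gamma>. d x (\<rho> g x) \<le> \<epsilon> \<and> d y (\<rho> g y) \<le> \<epsilon>} \<and>
        card {g \<in> carrier \<Gamma>. d x (\<rho> g x) \<le> \<epsilon> \<and> d y (\<rho> g y) \<le> \<epsilon>} \<le> N)"

text \<open>
  The accumulation points in the boundary of the orbits of \<open>\<Gamma>\<close>. All orbits of an isometric action
  have the same accumulation points, so no base point is fixed.
\<close>

definition limit_set ::
  "('g, 'm) monoid_scheme \<Rightarrow> 'x set \<Rightarrow> ('x \<Rightarrow> 'x \<Rightarrow> real) \<Rightarrow> ('g \<Rightarrow> 'x \<Rightarrow> 'x) \<Rightarrow>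
    (nat \<Rightarrow> 'x) set set" where
  "limit_set \<Gamma> M d \<rho> =
     {\<xi> \<in> gromov_boundary M d. \<exists>s \<in> \<xi>. \<exists>x \<in> M. range s \<subseteq> orbit \<Gamma> \<rho> x}"

definition non_elementary_action ::
  "('g, 'm) monoid_scheme \<Rightarrow> 'x set \<Rightarrow> ('x \<Rightarrow> 'x \<Rightarrow> real) \<Rightarrow> ('g \<Rightarrow> 'x \<Rightarrow> 'x) \<Rightarrow> bool" where
  "non_elementary_action \<Gamma> M d \<rho> \<longleftrightarrow> infinite (limit_set \<Gamma> M d \<rho>)"

text \<open>
  HOL cannot quantify over types inside a formula, so the type \<open>'x\<close> that contains the points of
  the space is an explicit parameter, like a universe level. The space itself is an arbitrary
  subset of \<open>'x\<close>. A theorem with \<open>'x\<close> free therefore covers spaces of every size; spaces in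
  two types \<open>'x\<close> and \<open>'y\<close> can both be transported to \<open>'x + 'y\<close>.
\<close>

definition acylindrically_hyperbolic :: "'x itself \<Rightarrow> ('g, 'm) monoid_scheme \<Rightarrow> bool" where
  "acylindrically_hyperbolic _ \<Gamma> \<longleftrightarrow>
     group \<Gamma> \<and>
     (\<exists>(M :: 'x set) d \<rho>.
        Metric_space M d \<and> geodesic_space M d \<and> gromov_hyperbolic M d \<and>
        acylindrical_action \<Gamma> M d \<rho> \<and> non_elementary_action \<Gamma> M d \<rho>)"

end

(*
  With \<Psi>(g, h) = inn(g) \<phi>(h), the group \<Psi>(S), where S is the semidirect product, contains Inn(G),
  and ker \<Psi> centralizes G in S. The kernel of \<Psi> is an extension of K by the center
  of G, so it is finite iff K is. Everything therefore rests on two facts about an infinite normal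
  subgroup N of a group acting acylindrically and non-elementarily on a hyperbolic space: N has the
  same limit set as the whole group (so a finite kernel of \<Psi> makes S act through Aut(G)), and the
  centralizer of N is finite (so if S is acylindrically hyperbolic then ker \<Psi> is finite).

  Both follow from one property of N: it contains pairs a, b with a x and b x arbitrarily far from x
  but with bounded Gromov product at x. If some element of N moves all points far, its powers are
  such pairs; if not, and there are no such pairs, the orbit of N tends to a single boundary
  point, and arbitrarily many elements almost fix a long geodesic in that direction, against
  acylindricity.
*)
theory Submission
  imports Defs
begin

section \<open>Hyperbolic spaces\<close>

text \<open>The spaces need not be proper, so geodesics have no limits and minimal displacements
  need not be attained. All arguments are therefore estimates on Gromov products of finitely many
  orbit points. Two far points of the orbit of N in different directions yield both facts.
  Conjugating such a pair by \<gamma> gives a point of the N-orbit in the direction of \<gamma> x,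
  for every \<gamma>, so N misses no limit point. If c commutes with a and b, then a x and b x look
  from c x much as they do from x, which puts c x near a line between them. An infinite ker \<Psi>
  is itself an infinite normal subgroup, so its orbit would have to approach three distinct limit
  points, and a line has only two ends. Finiteness of the center enters twice: in the size of ker
  \<Psi>, and in making Inn(G) infinite, so that inside Aut(G) it has the full limit set. That G is
  infinite comes from Aut(G), whose orbits are unbounded.\<close>

lemma gromov_products_diverge_iff:
  "gromov_products_diverge M d s t \<longleftrightarrow>
     (\<forall>p\<in>M. \<forall>B. \<exists>n. \<forall>i\<ge>n. \<forall>j\<ge>n. B \<le> gromov_product d p (s i) (t j))"
proof -
  have "(\<exists>n. \<forall>j\<ge>n. \<forall>i\<ge>n. P i j) \<longleftrightarrow> (\<exists>n. \<forall>i\<ge>n. \<forall>j\<ge>n. P i j)"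
    for P :: "nat \<Rightarrow> nat \<Rightarrow> bool"
    by blast
  from this[of "\<lambda>i j. B \<le> gromov_product d p (s i) (t j)" for B p] show ?thesis
    unfolding gromov_products_diverge_def filterlim_at_top eventually_prod_sequentially prod.case
    by simp
qed

section \<open>Gromov products and the four-point inequality\<close>

locale gromov_hyperbolic_space = Metric_space M d
  for M :: "'x set" and d :: "'x \<Rightarrow> 'x \<Rightarrow> real" +
  fixes \<delta> :: real
  assumes delta_nonneg: "0 \<le> \<delta>"
    and hyperbolic: "\<lbrakk>p \<in> M; x \<in> M; y \<in> M; z \<in> M\<rbrakk> \<Longrightarrow>
      min (gromov_product d p x y) (gromov_product d p y z) - \<delta> \<le> gromov_product d p x z"
    and geodesic: "geodesic_space M d"
begin

abbreviation gp :: "'x \<Rightarrow> 'x \<Rightarrow> 'x \<Rightarrow> real" where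
  "gp \<equiv> gromov_product d"

lemma gp_double: "2 * gp p x y = d p x + d p y - d x y"
  by (simp add: gromov_product_def commute)

lemma gp_commute: "gp p x y = gp p y x"
  using gp_double[of p x y] gp_double[of p y x] commute[of x y] by linarith

lemma gp_nonneg:
  assumes "p \<in> M" "x \<in> M" "y \<in> M"
  shows "0 \<le> gp p x y"
  using triangle[of x p y] assms gp_double[of p x y] commute[of p x] by linarith

lemma gp_self: "x \<in> M \<Longrightarrow> gp p x x = d p x"
  using gp_double[of p x x] by simp

text \<open>In a tripod the branch point of \<open>y\<close> cuts the segment from \<open>p\<close>
  to \<open>x\<close> into two parts whose lengths are these products. A small product at one end
  thus becomes a large one at the other.\<close>

lemma gp_swap: "gp p x y + gp x p y = d p x"
  using gp_double[of p x y] gp_double[of x p y] commute[of p x] by linarith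

lemma gp_ge_dist_diff:
  assumes "p \<in> M" "x \<in> M" "y \<in> M"
  shows "d p x - d x y \<le> gp p x y"
  using triangle[of p y x] assms gp_double[of p x y] commute[of y x] by linarith

lemma gp_change_base:
  assumes "p \<in> M" "q \<in> M" "x \<in> M" "y \<in> M"
  shows "gp p x y \<le> gp q x y + d p q"
  using triangle[of p q x] triangle[of p q y] assms gp_double[of p x y] gp_double[of q x y]
  by linarith

lemma gp_change_point:
  assumes "p \<in> M" "x \<in> M" "x' \<in> M" "y \<in> M"
  shows "gp p x y \<le> gp p x' y + d x x'"
  using triangle[of p x' x] triangle[of x' x y] assms gp_double[of p x y] gp_double[of p x' y]
    commute[of x' x] by linarith

lemma hyperbolic3:
  assumes "p \<in> M" "x \<in> M" "y \<in> M" "z \<in> M" "w \<in> M"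
  shows "min (gp p x y) (min (gp p y z) (gp p z w)) - 2 * \<delta> \<le> gp p x w"
  using hyperbolic[of p x y w] hyperbolic[of p y z w] assms delta_nonneg by linarith

text \<open>The hyperbolicity inequality with the base point cleared: of the three sums of opposite
  distances, the largest two nearly agree.\<close>

lemma four_point:
  assumes "p \<in> M" "x \<in> M" "y \<in> M" "z \<in> M"
  shows "d x z + d y p \<le> max (d x y + d z p) (d y z + d x p) + 2 * \<delta>"
  using hyperbolic[OF assms] gp_double[of p x y] gp_double[of p y z] gp_double[of p x z]
    commute[of p x] commute[of p y] commute[of p z] by linarith

text \<open>Both points lie on one geodesic, so their distance is exact; acylindricity will be
  tested on such a pair.\<close>

lemma geodesic_points:
  assumes "x \<in> M" "y \<in> M" "0 \<le> s" "s \<le> t" "t \<le> d x y"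
  obtains z w where "z \<in> M" "d x z = s" "d z y = d x y - s"
    "w \<in> M" "d x w = t" "d w y = d x y - t" "d z w = t - s"
proof -
  obtain \<gamma> where g: "\<gamma> ` {0..d x y} \<subseteq> M" "\<gamma> 0 = x" "\<gamma> (d x y) = y"
    "\<forall>s\<in>{0..d x y}. \<forall>t\<in>{0..d x y}. d (\<gamma> s) (\<gamma> t) = \<bar>s - t\<bar>"
    using geodesic assms unfolding geodesic_space_def by meson
  have t: "t \<in> {0..d x y}" "s \<in> {0..d x y}" "0 \<in> {0..d x y}" "d x y \<in> {0..d x y}"
    using assms by auto
  have "d (\<gamma> 0) (\<gamma> t) = \<bar>0 - t\<bar>" "d (\<gamma> t) (\<gamma> (d x y)) = \<bar>t - d x y\<bar>"
    "d (\<gamma> 0) (\<gamma> s) = \<bar>0 - s\<bar>" "d (\<gamma> s) (\<gamma> (d x y)) = \<bar>s - d x y\<bar>" "d (\<gamma> s) (\<gamma> t) = \<bar>s - t\<bar>"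
    using g(4) t by blast+
  moreover have "\<gamma> t \<in> M" "\<gamma> s \<in> M" using g(1) t by blast+
  ultimately show thesis using that[of "\<gamma> s" "\<gamma> t"] g(2,3) assms by auto
qed

lemma midpoint:
  assumes "x \<in> M" "y \<in> M"
  obtains m where "m \<in> M" "d x m = d x y / 2" "d m y = d x y / 2"
proof (rule geodesic_points[OF assms, of "d x y / 2" "d x y / 2"])
  fix z w
  assume "z \<in> M" "d x z = d x y / 2" "d z y = d x y - d x y / 2"
  then show thesis using that[of z] by (simp add: field_simps)
qed simp_all

section \<open>Sequences converging to the Gromov boundary\<close>

lemma diverge_iff:
  assumes "p \<in> M" "range s \<subseteq> M" "range t \<subseteq> M"
  shows "gromov_products_diverge M d s t \<longleftrightarrow>
    (\<forall>B. \<exists>n. \<forall>i\<ge>n. \<forall>j\<ge>n. B \<le> gp p (s i) (t j))"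
proof
  assume R: "\<forall>B. \<exists>n. \<forall>i\<ge>n. \<forall>j\<ge>n. B \<le> gp p (s i) (t j)"
  show "gromov_products_diverge M d s t"
    unfolding gromov_products_diverge_iff
  proof (intro ballI allI)
    fix q B assume q: "q \<in> M"
    from R obtain n where n: "\<forall>i\<ge>n. \<forall>j\<ge>n. B + d p q \<le> gp p (s i) (t j)" by blast
    have "B \<le> gp q (s i) (t j)" if "i \<ge> n" "j \<ge> n" for i j
    proof -
      have "s i \<in> M" "t j \<in> M" using assms by auto
      moreover have "B + d p q \<le> gp p (s i) (t j)" using n that by blast
      ultimately show ?thesis using gp_change_base[of p q "s i" "t j"] assms(1) q by linarith
    qed
    then show "\<exists>n. \<forall>i\<ge>n. \<forall>j\<ge>n. B \<le> gp q (s i) (t j)" by blast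
  qed
next
  assume "gromov_products_diverge M d s t"
  then show "\<forall>B. \<exists>n. \<forall>i\<ge>n. \<forall>j\<ge>n. B \<le> gp p (s i) (t j)"
    using assms(1) unfolding gromov_products_diverge_iff by (rule bspec)
qed

lemma diverge_sym:
  "gromov_products_diverge M d s t \<Longrightarrow> gromov_products_diverge M d t s"
proof -
  have "gp p (t i) (s j) = gp p (s j) (t i)" for p i j by (rule gp_commute)
  then show "gromov_products_diverge M d s t \<Longrightarrow> ?thesis"
    unfolding gromov_products_diverge_iff by (simp, blast)
qed

lemma diverge_trans:
  assumes "range s \<subseteq> M" "range t \<subseteq> M" "range u \<subseteq> M"
    and "gromov_products_diverge M d s t" "gromov_products_diverge M d t u"
  shows "gromov_products_diverge M d s u"
  unfolding gromov_products_diverge_iff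
proof (intro ballI allI)
  fix p B assume p: "p \<in> M"
  obtain n where n: "\<forall>i\<ge>n. \<forall>j\<ge>n. B + \<delta> \<le> gp p (s i) (t j)"
    using assms(4) p unfolding gromov_products_diverge_iff by blast
  obtain m where m: "\<forall>i\<ge>m. \<forall>j\<ge>m. B + \<delta> \<le> gp p (t i) (u j)"
    using assms(5) p unfolding gromov_products_diverge_iff by blast
  have "B \<le> gp p (s i) (u j)" if "i \<ge> max n m" "j \<ge> max n m" for i j
  proof -
    have "B + \<delta> \<le> gp p (s i) (t (max n m))" "B + \<delta> \<le> gp p (t (max n m)) (u j)"
      using n m that by auto
    moreover have "s i \<in> M" "t (max n m) \<in> M" "u j \<in> M" using assms(1-3) by auto
    ultimately show ?thesis using hyperbolic[of p "s i" "t (max n m)" "u j"] p by linarith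
  qed
  then show "\<exists>n. \<forall>i\<ge>n. \<forall>j\<ge>n. B \<le> gp p (s i) (u j)" by blast
qed

lemma gromov_sequence_unbounded:
  assumes "s \<in> gromov_sequences M d" "p \<in> M"
  obtains n where "\<And>i. i \<ge> n \<Longrightarrow> B \<le> d p (s i)"
proof -
  have r: "range s \<subseteq> M" and g: "gromov_products_diverge M d s s"
    using assms unfolding gromov_sequences_def by auto
  then obtain n where "\<forall>i\<ge>n. \<forall>j\<ge>n. B \<le> gp p (s i) (s j)"
    using assms(2) unfolding gromov_products_diverge_iff by blast
  then have "B \<le> d p (s i)" if "i \<ge> n" for i
    using that r gp_self[of "s i" p] by (metis range_subsetD)
  then show thesis using that by blast
qed

lemma boundary_member_sequence:
  "\<lbrakk>\<xi> \<in> gromov_boundary M d; s \<in> \<xi>\<rbrakk> \<Longrightarrow> s \<in> gromov_sequences M d"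
  by (auto simp: gromov_boundary_def quotient_def)

lemma boundary_member_iff:
  assumes "\<xi> \<in> gromov_boundary M d" "s \<in> \<xi>"
  shows "t \<in> \<xi> \<longleftrightarrow> t \<in> gromov_sequences M d \<and> gromov_products_diverge M d s t"
proof -
  obtain u where u: "u \<in> gromov_sequences M d"
    "\<xi> = {t \<in> gromov_sequences M d. gromov_products_diverge M d u t}"
    using assms(1) by (auto simp: gromov_boundary_def quotient_def)
  then have "gromov_products_diverge M d u s" "s \<in> gromov_sequences M d" using assms(2) by auto
  then show ?thesis
    using u diverge_trans[of s u t] diverge_trans[of u s t] diverge_sym[of u s]
    by (auto simp: gromov_sequences_def)
qed

text \<open>The product of \<open>s i\<close> and \<open>t i\<close> is within \<open>c\<close> of
  its largest possible value \<open>d p (s i)\<close>, which tends to infinity, so \<open>t\<close>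
  follows \<open>s\<close>. That \<open>t\<close> is a Gromov sequence is part of the
  conclusion.\<close>

lemma shadowing_sequence_in_boundary_class:
  assumes \<xi>: "\<xi> \<in> gromov_boundary M d" "s \<in> \<xi>" and "p \<in> M" "range t \<subseteq> M"
    and close: "\<And>i. d p (s i) - c \<le> gp p (s i) (t i)"
  shows "t \<in> \<xi>"
proof -
  have sg: "s \<in> gromov_sequences M d" using boundary_member_sequence \<xi> by blast
  then have r: "range s \<subseteq> M" and g: "gromov_products_diverge M d s s"
    unfolding gromov_sequences_def by auto
  have M: "s i \<in> M" "t i \<in> M" for i using r assms(4) by auto
  have st: "gromov_products_diverge M d s t"
    unfolding diverge_iff[OF assms(3) r assms(4)]
  proof
    fix B
    obtain n where n: "\<forall>i\<ge>n. \<forall>j\<ge>n. B + \<delta> \<le> gp p (s i) (s j)"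
      using g unfolding diverge_iff[OF assms(3) r r] by blast
    obtain m where m: "\<And>i. i \<ge> m \<Longrightarrow> B + \<delta> + c \<le> d p (s i)"
      using gromov_sequence_unbounded[OF sg assms(3)] by blast
    have "B \<le> gp p (s i) (t j)" if "i \<ge> max n m" "j \<ge> max n m" for i j
      using hyperbolic[of p "s i" "s j" "t j"] n m[of j] that assms(3) M close[of j] by force
    then show "\<exists>n. \<forall>i\<ge>n. \<forall>j\<ge>n. B \<le> gp p (s i) (t j)" by blast
  qed
  then have "gromov_products_diverge M d t t"
    using diverge_trans[of t s t] diverge_sym[of s t] r assms(4) by blast
  then show ?thesis
    using boundary_member_iff[OF \<xi>] st assms(4) by (simp add: gromov_sequences_def)
qed

text \<open>Failure of divergence only gives one bound \<open>B\<close> that is attained arbitrarily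
  far out. Since the late terms of each sequence share a direction, a single such pair of terms
  controls all of them, at the cost of \<open>2 * \<delta>\<close>.\<close>

lemma distinct_boundary_points_bounded_product:
  assumes "\<xi> \<in> gromov_boundary M d" "s \<in> \<xi>" "\<eta> \<in> gromov_boundary M d" "t \<in> \<eta>" "\<xi> \<noteq> \<eta>" "p \<in> M"
  shows "\<exists>B n. \<forall>i\<ge>n. \<forall>j\<ge>n. gp p (s i) (t j) \<le> B"
proof -
  have sg: "s \<in> gromov_sequences M d" "t \<in> gromov_sequences M d"
    using boundary_member_sequence assms by blast+
  then have r: "range s \<subseteq> M" "range t \<subseteq> M"
    and g: "gromov_products_diverge M d s s" "gromov_products_diverge M d t t"
    unfolding gromov_sequences_def by auto
  have M: "s i \<in> M" "t i \<in> M" for i using r by auto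
  have "\<not> gromov_products_diverge M d s t"
  proof
    assume st: "gromov_products_diverge M d s t"
    have "t \<in> \<xi>" using boundary_member_iff[OF assms(1,2)] st sg by blast
    then have "\<xi> = \<eta>"
      using boundary_member_iff[OF assms(1) \<open>t \<in> \<xi>\<close>] boundary_member_iff[OF assms(3,4)] by blast
    then show False using assms(5) by blast
  qed
  then obtain B where B: "\<And>n. \<exists>i\<ge>n. \<exists>j\<ge>n. gp p (s i) (t j) < B"
    unfolding diverge_iff[OF assms(6) r] by (meson not_le)
  obtain n where n: "\<forall>i\<ge>n. \<forall>j\<ge>n. B + 2 * \<delta> \<le> gp p (s i) (s j)"
    using g(1) unfolding diverge_iff[OF assms(6) r(1) r(1)] by blast
  obtain m where m: "\<forall>i\<ge>m. \<forall>j\<ge>m. B + 2 * \<delta> \<le> gp p (t i) (t j)"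
    using g(2) unfolding diverge_iff[OF assms(6) r(2) r(2)] by blast
  obtain i' j' where ij: "i' \<ge> max n m" "j' \<ge> max n m" "gp p (s i') (t j') < B"
    using B[of "max n m"] by blast
  have "gp p (s i) (t j) \<le> B + 2 * \<delta>" if "i \<ge> max n m" "j \<ge> max n m" for i j
  proof -
    have "B + 2 * \<delta> \<le> gp p (s i') (s i)" using n ij that by auto
    moreover have "B + 2 * \<delta> \<le> gp p (t j) (t j')" using m ij that by auto
    ultimately show ?thesis
      using hyperbolic3[of p "s i'" "s i" "t j" "t j'"] ij(3) assms(6) M by fastforce
  qed
  then show ?thesis by blast
qed

text \<open>The broken geodesic through the points \<open>u 0, u 1, \<dots>\<close> has long segments and hardly
  backtracks at its corners, so it is a local, hence a global, quasi-geodesic.\<close>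

lemma local_to_global:
  assumes u: "\<And>i. u i \<in> M" and step: "\<And>i. d (u i) (u (Suc i)) = D"
    and turn: "\<And>i. gp (u (Suc i)) (u i) (u (Suc (Suc i))) \<le> C"
    and D: "2 * C + 2 * \<delta> < D"
  shows "gp (u (Suc n)) (u 0) (u (Suc (Suc n))) \<le> C + \<delta>"
proof (induction n)
  case 0
  then show ?case using turn[of 0] delta_nonneg by simp
next
  case (Suc n)
  \<comment> \<open>This product exceeds \<open>C + \<delta>\<close> by the choice of
    \<open>D\<close>, so the other product must be the minimum in the hyperbolicity
    inequality.\<close>
  have "gp (u (Suc (Suc n))) (u (Suc n)) (u 0) \<ge> D - (C + \<delta>)"
    using Suc gp_swap[of "u (Suc n)" "u (Suc (Suc n))" "u 0"] step[of "Suc n"]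
    by (simp add: gp_commute)
  then show ?case
    using hyperbolic[of "u (Suc (Suc n))" "u (Suc n)" "u 0" "u (Suc (Suc (Suc n)))"]
      turn[of "Suc n"] u D by fastforce
qed

lemma local_to_global_dist:
  assumes u: "\<And>i. u i \<in> M" and step: "\<And>i. d (u i) (u (Suc i)) = D"
    and turn: "\<And>i. gp (u (Suc i)) (u i) (u (Suc (Suc i))) \<le> C"
    and D: "2 * C + 2 * \<delta> < D"
  shows "real n * (D - 2 * C - 2 * \<delta>) \<le> d (u 0) (u n)"
proof (induction n)
  case (Suc n)
  show ?case
  proof (cases n)
    case 0
    \<comment> \<open>The first segment has no corner before it; it is long enough because
      \<open>C\<close> bounds a Gromov product and so is nonnegative.\<close>
    have "0 \<le> C" using turn[of 0] gp_nonneg[of "u 1" "u 0" "u 2"] u by (simp add: numeral_2_eq_2)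
    then show ?thesis using step[of 0] delta_nonneg 0 by simp
  next
    case (Suc k)
    have "d (u 0) (u (Suc n)) = d (u 0) (u n) + D - 2 * gp (u n) (u 0) (u (Suc n))"
      using step[of n] gp_double[of "u n" "u 0" "u (Suc n)"] commute[of "u n" "u 0"] by linarith
    moreover have "gp (u n) (u 0) (u (Suc n)) \<le> C + \<delta>"
      using local_to_global[of u D C k, OF u step turn D] Suc by simp
    moreover have "real (Suc n) * (D - 2 * C - 2 * \<delta>) =
        real n * (D - 2 * C - 2 * \<delta>) + (D - 2 * C - 2 * \<delta>)"
      by (simp add: algebra_simps)
    ultimately show ?thesis using Suc.IH by linarith
  qed
qed simp

end

section \<open>Isometric actions on hyperbolic spaces\<close>

locale hyperbolic_action = gromov_hyperbolic_space M d \<delta>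
  for M :: "'x set" and d :: "'x \<Rightarrow> 'x \<Rightarrow> real" and \<delta> :: real +
  fixes \<Gamma> :: "('g, 'm) monoid_scheme" (structure) and \<rho> :: "'g \<Rightarrow> 'x \<Rightarrow> 'x"
  assumes isometric: "isometric_action \<Gamma> M d \<rho>"
begin

lemma action: "group_action \<Gamma> M \<rho>"
  using isometric by (simp add: isometric_action_def)

sublocale act: group \<Gamma>
  using action by (simp add: group_action_def group_hom_def)

lemma act_closed: "\<lbrakk>g \<in> carrier \<Gamma>; x \<in> M\<rbrakk> \<Longrightarrow> \<rho> g x \<in> M"
  using group_action.element_image[OF action] by blast

lemma act_mult: "\<lbrakk>g \<in> carrier \<Gamma>; h \<in> carrier \<Gamma>; x \<in> M\<rbrakk> \<Longrightarrow> \<rho> (g \<otimes> h) x = \<rho> g (\<rho> h x)"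
  using group_action.composition_rule[OF action] by blast

lemma act_one: "x \<in> M \<Longrightarrow> \<rho> \<one> x = x"
  using group_action.id_eq_one[OF action] by (metis restrict_apply')

lemma act_inv: "\<lbrakk>g \<in> carrier \<Gamma>; x \<in> M\<rbrakk> \<Longrightarrow> \<rho> g (\<rho> (inv g) x) = x"
  using act_mult[of g "inv g" x] act_one by simp

lemma act_dist: "\<lbrakk>g \<in> carrier \<Gamma>; x \<in> M; y \<in> M\<rbrakk> \<Longrightarrow> d (\<rho> g x) (\<rho> g y) = d x y"
  using isometric by (simp add: isometric_action_def)

lemma act_gp:
  "\<lbrakk>g \<in> carrier \<Gamma>; p \<in> M; x \<in> M; y \<in> M\<rbrakk> \<Longrightarrow> gp (\<rho> g p) (\<rho> g x) (\<rho> g y) = gp p x y"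
  by (simp add: gromov_product_def act_dist)

lemma dist_act_inv:
  assumes "g \<in> carrier \<Gamma>" "x \<in> M" "y \<in> M"
  shows "d (\<rho> (inv g) x) y = d x (\<rho> g y)"
  using act_dist[of g "\<rho> (inv g) x" y] assms by (simp add: act_inv act_closed)

lemma gp_act_inv:
  assumes "g \<in> carrier \<Gamma>" "p \<in> M" "x \<in> M" "y \<in> M"
  shows "gp (\<rho> g p) x y = gp p (\<rho> (inv g) x) (\<rho> (inv g) y)"
  using act_gp[of g p "\<rho> (inv g) x" "\<rho> (inv g) y"] assms by (simp add: act_inv act_closed)

section \<open>Pairs of far orbit points in different directions\<close>

lemma displacement_change_base:
  assumes "g \<in> carrier \<Gamma>" "x \<in> M" "y \<in> M"
  shows "d x (\<rho> g x) \<le> d y (\<rho> g y) + 2 * d x y"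
  using triangle[of x y "\<rho> g x"] triangle[of y "\<rho> g y" "\<rho> g x"] act_dist[of g y x]
    commute[of x y] assms act_closed by force

text \<open>The constant \<open>C\<close> is chosen before \<open>L\<close>, so one bound serves
  pairs of every length. The pairs take the place of a loxodromic element; no relation between
  \<open>a\<close> and \<open>b\<close> is asked for.\<close>

definition diverging_pairs :: "'g set \<Rightarrow> 'x \<Rightarrow> bool" where
  "diverging_pairs A x \<longleftrightarrow> (\<exists>C. \<forall>L. \<exists>a\<in>A. \<exists>b\<in>A.
     L \<le> d x (\<rho> a x) \<and> L \<le> d x (\<rho> b x) \<and> gp x (\<rho> a x) (\<rho> b x) \<le> C)"

text \<open>A displacement changes by at most \<open>2 * d x y\<close>, and the product by
  \<open>3 * d x y\<close>: once for the base point and once for each orbit point.\<close>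

lemma diverging_pairs_change_base:
  assumes "diverging_pairs A x" "A \<subseteq> carrier \<Gamma>" "x \<in> M" "y \<in> M"
  shows "diverging_pairs A y"
proof -
  obtain C where C: "\<And>L. \<exists>a\<in>A. \<exists>b\<in>A.
     L \<le> d x (\<rho> a x) \<and> L \<le> d x (\<rho> b x) \<and> gp x (\<rho> a x) (\<rho> b x) \<le> C"
    using assms(1) unfolding diverging_pairs_def by blast
  show ?thesis
    unfolding diverging_pairs_def
  proof (intro exI allI)
    fix L
    obtain a b where ab: "a \<in> A" "b \<in> A" "L + 2 * d x y \<le> d x (\<rho> a x)"
      "L + 2 * d x y \<le> d x (\<rho> b x)" "gp x (\<rho> a x) (\<rho> b x) \<le> C"
      using C by blast
    have G: "a \<in> carrier \<Gamma>" "b \<in> carrier \<Gamma>" using ab assms(2) by auto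
    note M = assms(3,4) act_closed[OF G(1)] act_closed[OF G(2)]
    have "L \<le> d y (\<rho> a y)" "L \<le> d y (\<rho> b y)"
      using displacement_change_base[of _ x y] ab(3,4) G assms by fastforce+
    moreover have "gp y (\<rho> a y) (\<rho> b y) \<le> gp x (\<rho> a y) (\<rho> b y) + d x y"
      using gp_change_base[of y x "\<rho> a y" "\<rho> b y"] M commute[of x y] by simp
    moreover have "gp x (\<rho> a y) (\<rho> b y) \<le> gp x (\<rho> a x) (\<rho> b y) + d x y"
      using gp_change_point[of x "\<rho> a y" "\<rho> a x" "\<rho> b y"] M act_dist[OF G(1), of y x] commute[of x y]
      by simp
    moreover have "gp x (\<rho> a x) (\<rho> b y) \<le> gp x (\<rho> a x) (\<rho> b x) + d x y"
      using gp_change_point[of x "\<rho> b y" "\<rho> b x" "\<rho> a x"] M act_dist[OF G(2), of y x] commute[of x y]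
        gp_commute by metis
    ultimately have "L \<le> d y (\<rho> a y) \<and> L \<le> d y (\<rho> b y) \<and> gp y (\<rho> a y) (\<rho> b y) \<le> C + 3 * d x y"
      using ab(5) by linarith
    then show "\<exists>a\<in>A. \<exists>b\<in>A. L \<le> d y (\<rho> a y) \<and> L \<le> d y (\<rho> b y) \<and>
        gp y (\<rho> a y) (\<rho> b y) \<le> C + 3 * d x y"
      using ab(1,2) by blast
  qed
qed

text \<open>Seen from \<open>\<gamma> x\<close>, one of the two far away points \<open>\<gamma> a x\<close> and \<open>\<gamma> b x\<close> is not in the
  direction of \<open>x\<close>, so its direction seen from \<open>x\<close> is that of \<open>\<gamma> x\<close>; and it is at bounded
  distance from the image of \<open>x\<close> under the conjugate of \<open>a\<close> or \<open>b\<close> by \<open>\<gamma>\<close>.\<close>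

lemma diverging_pairs_shadow:
  assumes N: "N \<lhd> \<Gamma>" and "diverging_pairs N x" "x \<in> M"
  obtains C where "\<And>\<gamma>. \<gamma> \<in> carrier \<Gamma> \<Longrightarrow> \<exists>m\<in>N. d x (\<rho> \<gamma> x) - C \<le> gp x (\<rho> \<gamma> x) (\<rho> m x)"
proof -
  have NG: "N \<subseteq> carrier \<Gamma>" using N normal_imp_subgroup subgroup.subset by blast
  obtain C where C: "\<And>L. \<exists>a\<in>N. \<exists>b\<in>N.
     L \<le> d x (\<rho> a x) \<and> L \<le> d x (\<rho> b x) \<and> gp x (\<rho> a x) (\<rho> b x) \<le> C"
    using assms(2) unfolding diverging_pairs_def by blast
  have "\<exists>m\<in>N. d x (\<rho> \<gamma> x) - (max C 0 + 2 * \<delta>) \<le> gp x (\<rho> \<gamma> x) (\<rho> m x)"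
    if \<gamma>: "\<gamma> \<in> carrier \<Gamma>" for \<gamma>
  proof -
    define L where "L = d x (\<rho> \<gamma> x)"
    \<comment> \<open>With displacement \<open>4 * L\<close> the conjugate \<open>m\<close> below
      still moves \<open>x\<close> by \<open>2 * L\<close>, which is \<open>L\<close> more than the
      distance from \<open>\<rho> m x\<close> to
      \<open>\<rho> \<gamma> (\<rho> c x)\<close>.\<close>
    obtain a b where ab: "a \<in> N" "b \<in> N" "4 * L \<le> d x (\<rho> a x)"
      "4 * L \<le> d x (\<rho> b x)" "gp x (\<rho> a x) (\<rho> b x) \<le> C"
      using C by blast
    have G: "a \<in> carrier \<Gamma>" "b \<in> carrier \<Gamma>" using ab NG by auto
    have M: "\<rho> \<gamma> x \<in> M" "\<rho> a x \<in> M" "\<rho> b x \<in> M" "\<rho> \<gamma> (\<rho> a x) \<in> M" "\<rho> \<gamma> (\<rho> b x) \<in> M"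
      using act_closed G \<gamma> assms(3) by simp_all
    have "min (gp (\<rho> \<gamma> x) (\<rho> \<gamma> (\<rho> a x)) x) (gp (\<rho> \<gamma> x) x (\<rho> \<gamma> (\<rho> b x))) - \<delta> \<le> C"
      using hyperbolic[of "\<rho> \<gamma> x" "\<rho> \<gamma> (\<rho> a x)" x "\<rho> \<gamma> (\<rho> b x)"] M assms(3) act_gp[OF \<gamma>] ab(5)
      by force
    then have "gp (\<rho> \<gamma> x) x (\<rho> \<gamma> (\<rho> a x)) \<le> C + \<delta> \<or> gp (\<rho> \<gamma> x) x (\<rho> \<gamma> (\<rho> b x)) \<le> C + \<delta>"
      using gp_commute[of "\<rho> \<gamma> x" x "\<rho> \<gamma> (\<rho> a x)"] by linarith
    then obtain c where c: "c \<in> N" "4 * L \<le> d x (\<rho> c x)" "gp (\<rho> \<gamma> x) x (\<rho> \<gamma> (\<rho> c x)) \<le> C + \<delta>"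
      using ab by blast
    have cG: "c \<in> carrier \<Gamma>" using c NG by blast
    define m where "m = \<gamma> \<otimes> c \<otimes> inv \<gamma>"
    have m: "m \<in> N" unfolding m_def using normal.inv_op_closed2[OF N] \<gamma> c by blast
    have mG: "m \<in> carrier \<Gamma>" using m NG by blast
    have cM: "\<rho> c x \<in> M" "\<rho> \<gamma> (\<rho> c x) \<in> M" "\<rho> m x \<in> M"
      using act_closed cG mG \<gamma> assms(3) by simp_all
    have "m \<otimes> \<gamma> = \<gamma> \<otimes> c" unfolding m_def using \<gamma> cG by (simp add: act.m_assoc)
    then have eq: "\<rho> \<gamma> (\<rho> c x) = \<rho> m (\<rho> \<gamma> x)"
      using act_mult mG cG \<gamma> assms(3) by metis
    have "d x (\<rho> c x) \<le> d (\<rho> \<gamma> x) (\<rho> \<gamma> (\<rho> c x))" using act_dist \<gamma> assms(3) cM by simp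
    also have "\<dots> \<le> d (\<rho> \<gamma> x) x + d x (\<rho> m x) + d (\<rho> m x) (\<rho> m (\<rho> \<gamma> x))"
      using triangle[of "\<rho> \<gamma> x" x "\<rho> \<gamma> (\<rho> c x)"] triangle[of x "\<rho> m x" "\<rho> \<gamma> (\<rho> c x)"]
        M assms(3) cM eq by simp
    also have "\<dots> = 2 * L + d x (\<rho> m x)"
      using act_dist[OF mG] M assms(3) commute[of "\<rho> \<gamma> x" x] by (simp add: L_def)
    finally have far: "2 * L \<le> d x (\<rho> m x)" using c(2) by linarith
    have 1: "L \<le> gp x (\<rho> m x) (\<rho> \<gamma> (\<rho> c x))"
      using gp_ge_dist_diff[of x "\<rho> m x" "\<rho> \<gamma> (\<rho> c x)"] far assms(3) cM M act_dist[OF mG]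
      unfolding eq by (simp add: L_def)
    have 2: "L - (C + \<delta>) \<le> gp x (\<rho> \<gamma> x) (\<rho> \<gamma> (\<rho> c x))"
      using gp_swap[of x "\<rho> \<gamma> x" "\<rho> \<gamma> (\<rho> c x)"] c(3) by (simp add: L_def)
    have "L - (max C 0 + 2 * \<delta>) \<le> gp x (\<rho> \<gamma> x) (\<rho> m x)"
      using hyperbolic[of x "\<rho> \<gamma> x" "\<rho> \<gamma> (\<rho> c x)" "\<rho> m x"] 1 2 cM M assms(3) delta_nonneg
        gp_commute[of x "\<rho> m x" "\<rho> \<gamma> (\<rho> c x)"] by linarith
    then show ?thesis using m unfolding L_def by blast
  qed
  then show thesis using that by blast
qed

text \<open>A sequence converging to \<open>\<xi>\<close> is shadowed term by term, with uniform
  loss, by the orbit of \<open>N\<close>. The sequence comes with its own base point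
  \<open>y\<close>; returning to \<open>x\<close> costs a further \<open>d x y\<close>.\<close>

lemma limit_point_in_normal_orbit:
  assumes N: "N \<lhd> \<Gamma>" and "diverging_pairs N x" "x \<in> M"
    and \<xi>: "\<xi> \<in> limit_set \<Gamma> M d \<rho>"
  obtains t where "t \<in> \<xi>" "range t \<subseteq> (\<lambda>g. \<rho> g x) ` N"
proof -
  have NG: "N \<subseteq> carrier \<Gamma>" using N normal_imp_subgroup subgroup.subset by blast
  obtain s y where s: "\<xi> \<in> gromov_boundary M d" "s \<in> \<xi>" "y \<in> M" "range s \<subseteq> orbit \<Gamma> \<rho> y"
    using \<xi> unfolding limit_set_def by blast
  have "\<exists>g \<in> carrier \<Gamma>. s i = \<rho> g y" for i
    using s(4) unfolding orbit_def by auto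
  then obtain g where g: "\<And>i. g i \<in> carrier \<Gamma>" "\<And>i. s i = \<rho> (g i) y" by metis
  obtain C where C: "\<And>\<gamma>. \<gamma> \<in> carrier \<Gamma> \<Longrightarrow> \<exists>m\<in>N. d y (\<rho> \<gamma> y) - C \<le> gp y (\<rho> \<gamma> y) (\<rho> m y)"
    using diverging_pairs_shadow[OF N diverging_pairs_change_base[OF assms(2) NG assms(3) s(3)] s(3)]
    by blast
  have "\<exists>m\<in>N. d y (s i) - C \<le> gp y (s i) (\<rho> m y)" for i
    using C[OF g(1)[of i]] g(2)[of i] by simp
  then obtain m where m: "\<And>i. m i \<in> N" "\<And>i. d y (s i) - C \<le> gp y (s i) (\<rho> (m i) y)"
    by metis
  have mG: "m i \<in> carrier \<Gamma>" for i using m(1) NG by blast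
  define t where "t i = \<rho> (m i) x" for i
  have "d y (s i) - (C + d x y) \<le> gp y (s i) (t i)" for i
    using gp_change_point[of y "\<rho> (m i) y" "t i" "s i"] m(2)[of i] act_dist[OF mG[of i], of x y] mG
      s(3) assms(3) g act_closed commute[of "t i" "\<rho> (m i) y"]
    unfolding t_def gp_commute[of _ "s i"] by (smt (verit))
  moreover have "range t \<subseteq> M" unfolding t_def using act_closed mG assms(3) by blast
  ultimately have "t \<in> \<xi>"
    using shadowing_sequence_in_boundary_class[OF s(1,2,3)] by blast
  moreover have "range t \<subseteq> (\<lambda>g. \<rho> g x) ` N" using m(1) unfolding t_def by blast
  ultimately show thesis using that by blast
qed

section \<open>Unbounded orbits and loxodromic isometries\<close>

lemma limit_set_nonempty_imp_unbounded:
  assumes "limit_set \<Gamma> M d \<rho> \<noteq> {}" "x \<in> M"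
  obtains g where "g \<in> carrier \<Gamma>" "L \<le> d x (\<rho> g x)"
proof -
  obtain \<xi> s y where s: "\<xi> \<in> gromov_boundary M d" "s \<in> \<xi>" "y \<in> M" "range s \<subseteq> orbit \<Gamma> \<rho> y"
    using assms unfolding limit_set_def by blast
  obtain n where "L + 2 * d y x \<le> d y (s n)"
    using gromov_sequence_unbounded[OF boundary_member_sequence[OF s(1,2)] s(3)] by blast
  moreover obtain g where g: "g \<in> carrier \<Gamma>" "s n = \<rho> g y"
    using s(4) unfolding orbit_def by auto
  ultimately show thesis
    using displacement_change_base[of g y x] assms(2) s(3) that by fastforce
qed

lemma limit_set_nonempty_imp_infinite:
  assumes "limit_set \<Gamma> M d \<rho> \<noteq> {}"
  shows "infinite (carrier \<Gamma>)"
proof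
  assume fin: "finite (carrier \<Gamma>)"
  obtain x where x: "x \<in> M" using assms unfolding limit_set_def by blast
  obtain g where g: "g \<in> carrier \<Gamma>" "(\<Sum>h\<in>carrier \<Gamma>. d x (\<rho> h x)) + 1 \<le> d x (\<rho> g x)"
    using limit_set_nonempty_imp_unbounded[OF assms x] by blast
  then show False
    using member_le_sum[of g "carrier \<Gamma>" "\<lambda>h. d x (\<rho> h x)"] fin by simp
qed

text \<open>The infimum of the displacement need not be attained, so the minimum is replaced by a
  point within 1 of it.\<close>

lemma almost_minimal_displacement:
  assumes "M \<noteq> {}"
  obtains x where "x \<in> M" "\<And>y. y \<in> M \<Longrightarrow> d x (\<rho> g x) \<le> d y (\<rho> g y) + 1"
proof -
  define S where "S = (\<lambda>y. d y (\<rho> g y)) ` M"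
  have S: "S \<noteq> {}" "bdd_below S" using assms by (auto simp: S_def intro!: bdd_belowI[of _ 0])
  have "Inf S < Inf S + 1" by simp
  then obtain x where x: "x \<in> M" "d x (\<rho> g x) < Inf S + 1"
    using cInf_lessD[OF S(1)] unfolding S_def by fastforce
  have "Inf S \<le> d y (\<rho> g y)" if "y \<in> M" for y
    using cInf_lower[OF _ S(2)] that unfolding S_def by blast
  then show thesis using that[OF x(1)] x(2) by fastforce
qed

text \<open>At a point of almost minimal displacement an isometry cannot backtrack, since otherwise the
  midpoint of \<open>x\<close> and \<open>g x\<close> would be moved less. Hence \<open>g\<close> is loxodromic.\<close>

lemma large_displacement_imp_diverging_pairs:
  assumes A: "subgroup A \<Gamma>" "g \<in> A" and "M \<noteq> {}"
    and large: "\<And>y. y \<in> M \<Longrightarrow> 7 * \<delta> + 2 \<le> d y (\<rho> g y)"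
  obtains x where "x \<in> M" "diverging_pairs A x"
proof -
  have g: "g \<in> carrier \<Gamma>" using A subgroup.subset by blast
  obtain x where x: "x \<in> M" and min: "\<And>y. y \<in> M \<Longrightarrow> d x (\<rho> g x) \<le> d y (\<rho> g y) + 1"
    using almost_minimal_displacement[OF assms(3)] by blast
  define D where "D = d x (\<rho> g x)"
  \<comment> \<open>Here \<open>2 * \<delta>\<close> is the loss in \<open>hyperbolic3\<close>, and
    \<open>1 / 2\<close> is half the slack in the minimality of \<open>x\<close>. The bound
    \<open>7 * \<delta> + 2\<close> exceeds \<open>2 * C + 3 * \<delta>\<close>, as the estimate of
    opposite powers requires.\<close>
  define C where "C = 2 * \<delta> + 1 / 2"
  have D: "7 * \<delta> + 2 \<le> D" using large[OF x] by (simp add: D_def)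
  have DC: "2 * C + 2 * \<delta> < D" using D delta_nonneg by (simp add: C_def)
  define z where "z k = \<rho> (g [^] (k::int)) x" for k
  have zM: "z k \<in> M" for k unfolding z_def using act_closed g x by simp
  have z_add: "z (j + k) = \<rho> (g [^] j) (z k)" for j k
    unfolding z_def using act_mult g x act.int_pow_mult by simp
  have z0: "z 0 = x" and z1: "z 1 = \<rho> g x" and z2: "z 2 = \<rho> g (\<rho> g x)"
    using act_one x act_mult g z_add[of 1 1] by (simp_all add: z_def)
  have dz: "d (z (k + i)) (z (k + j)) = d (z i) (z j)" for i j k
    unfolding z_add using act_dist g zM by simp
  have gpz: "gp (z (k + i)) (z (k + j)) (z (k + l)) = gp (z i) (z j) (z l)" for i j k l
    unfolding z_add using act_gp g zM by simp
  have D01: "d (z 0) (z 1) = D" by (simp add: z0 z1 D_def)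
  have turn0: "gp (z 1) (z 0) (z 2) \<le> C"
  proof -
    obtain m where m: "m \<in> M" "d x m = D / 2" "d m (\<rho> g x) = D / 2"
      using midpoint[OF x act_closed[OF g x]] unfolding D_def by blast
    have gM: "\<rho> g x \<in> M" "\<rho> g m \<in> M" "\<rho> g (\<rho> g x) \<in> M" using act_closed g x m by simp_all
    have "gp (\<rho> g x) m x = D / 2"
      using gp_double[of "\<rho> g x" m x] m commute[of "\<rho> g x" m] commute[of "\<rho> g x" x]
        commute[of m x] by (simp add: D_def)
    moreover have "gp (\<rho> g x) (\<rho> g (\<rho> g x)) (\<rho> g m) = D / 2"
      using gp_double[of x "\<rho> g x" m] m commute[of "\<rho> g x" m] act_gp[OF g x gM(1) m(1)]
      by (simp add: D_def)
    ultimately have "min (D / 2) (gp (\<rho> g x) x (\<rho> g (\<rho> g x))) - 2 * \<delta> \<le> gp (\<rho> g x) m (\<rho> g m)"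
      using hyperbolic3[of "\<rho> g x" m x "\<rho> g (\<rho> g x)" "\<rho> g m"] gM m x by linarith
    \<comment> \<open>Both midpoints are at distance \<open>D / 2\<close> from
      \<open>\<rho> g x\<close>, so the left side is \<open>D - d m (\<rho> g m)\<close>.\<close>
    moreover have "2 * gp (\<rho> g x) m (\<rho> g m) \<le> 1"
      using gp_double[of "\<rho> g x" m "\<rho> g m"] min[OF m(1)] m act_dist[OF g x m(1)]
        commute[of "\<rho> g x" m] by (simp add: D_def)
    ultimately show ?thesis using D delta_nonneg unfolding z0 z1 z2 C_def by linarith
  qed
  have step: "d (z k) (z (k + 1)) = D" for k
    using dz[of k 0 1] D01 by simp
  have turn: "gp (z (k + 1)) (z k) (z (k + 2)) \<le> C" for k
    using gpz[of k 1 0 2] turn0 by simp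
  have u_step: "d (z (k + int i)) (z (k + int (Suc i))) = D" for k i
    using step[of "k + int i"] by (simp add: algebra_simps)
  have u_turn: "gp (z (k + int (Suc i))) (z (k + int i)) (z (k + int (Suc (Suc i)))) \<le> C" for k i
    using turn[of "k + int i"] by (simp add: algebra_simps)
  have v_step: "d (z (k - int i)) (z (k - int (Suc i))) = D" for k i
    using step[of "k - int (Suc i)"] commute by (simp add: algebra_simps)
  have v_turn: "gp (z (k - int (Suc i))) (z (k - int i)) (z (k - int (Suc (Suc i)))) \<le> C" for k i
    using turn[of "k - int (Suc (Suc i))"] gp_commute by (simp add: algebra_simps)
  have far: "real n \<le> d x (z (int n))" "real n \<le> d x (z (- int n))" for n
  proof -
    \<comment> \<open>By the choice of \<open>C\<close>, every step gains at least 1.\<close>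
    have "real n * 1 \<le> real n * (D - 2 * C - 2 * \<delta>)"
      using D delta_nonneg by (intro mult_left_mono) (simp_all add: C_def)
    then show "real n \<le> d x (z (int n))" "real n \<le> d x (z (- int n))"
      using local_to_global_dist[of "\<lambda>i. z (0 + int i)", OF zM u_step u_turn DC, of n]
        local_to_global_dist[of "\<lambda>i. z (0 - int i)", OF zM v_step v_turn DC, of n] z0
      by simp_all
  qed
  \<comment> \<open>Seen from \<open>x\<close>, \<open>z n\<close> lies in the direction of
    \<open>z 1\<close> while \<open>z (- n)\<close> does not. The first claim uses the corner at
    \<open>z 1\<close> of the reversed line from \<open>z n\<close> to \<open>x\<close>, hence
    \<open>n \<ge> 2\<close>.\<close>
  have bounded: "gp x (z (int n)) (z (- int n)) \<le> C + 2 * \<delta>" if "n \<ge> 2" for n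
  proof -
    define m where "m = n - 2"
    have m: "n = Suc (Suc m)" using that by (simp add: m_def)
    have "gp x (z (- int n)) (z 1) \<le> C + \<delta>"
      using local_to_global[of "\<lambda>i. z (- int n + int i)", OF zM u_step u_turn DC, of "Suc m"] m z0
      by simp
    moreover have "gp (z 1) (z (int n)) (z 0) \<le> C + \<delta>"
      using local_to_global[of "\<lambda>i. z (int n - int i)", OF zM v_step v_turn DC, of m] m by simp
    then have "D - (C + \<delta>) \<le> gp x (z 1) (z (int n))"
      using gp_swap[of x "z 1" "z (int n)"] gp_commute[of "z 1" x "z (int n)"] D01 z0 by simp
    ultimately show ?thesis
      using hyperbolic[OF x zM[of "- int n"] zM[of "int n"] zM[of 1]] D delta_nonneg
        gp_commute[of x "z 1" "z (int n)"] gp_commute[of x "z (- int n)" "z (int n)"]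
      unfolding C_def by linarith
  qed
  have "diverging_pairs A x"
    unfolding diverging_pairs_def
  proof (intro exI allI)
    fix L
    obtain n :: nat where n: "max L 2 \<le> real n" using real_arch_simple by blast
    have "g [^] int n \<in> A" "g [^] (- int n) \<in> A"
      using act.subgroup_int_pow_closed[OF A] by blast+
    moreover have "L \<le> d x (z (int n))" "L \<le> d x (z (- int n))"
      using far[of n] n by linarith+
    moreover have "gp x (z (int n)) (z (- int n)) \<le> C + 2 * \<delta>" using bounded n by simp
    ultimately show "\<exists>a\<in>A. \<exists>b\<in>A. L \<le> d x (\<rho> a x) \<and> L \<le> d x (\<rho> b x) \<and>
        gp x (\<rho> a x) (\<rho> b x) \<le> C + 2 * \<delta>"
      unfolding z_def by blast
  qed
  then show thesis using that x by blast
qed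

text \<open>If \<open>g\<close> moves some point by at most \<open>D0\<close> and almost fixes the direction of the far away
  point \<open>p\<close>, then it changes the distance to \<open>p\<close> by at most about \<open>D0\<close>, that is, it
  hardly translates along the geodesic from \<open>x\<close> to \<open>p\<close>.\<close>

lemma almost_fixes_geodesic:
  assumes g: "g \<in> carrier \<Gamma>" and M: "x \<in> M" "y \<in> M" "p \<in> M" "z \<in> M"
    and D: "d x (\<rho> g x) \<le> D" "d x y \<le> D" and y: "d y (\<rho> g y) \<le> D0"
    and T: "T \<le> gp x p (\<rho> g p)" "T \<le> gp x p (\<rho> (inv g) p)"
    and z: "d x z = t" "d z p = d x p - t" "D \<le> t" "t + D \<le> T"
  shows "d z (\<rho> g z) \<le> 3 * D0 + 12 * \<delta>"
proof -
  define q where "q = \<rho> (inv g) p"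
  have gM: "q \<in> M" "\<rho> g x \<in> M" "\<rho> g y \<in> M" "\<rho> g z \<in> M" "\<rho> g p \<in> M"
    using act_closed g M by (simp_all add: q_def)
  have qx: "d x q = d (\<rho> g x) p" and qy: "d y q = d (\<rho> g y) p"
    using dist_act_inv[OF g M(3)] M commute by (simp_all add: q_def)
  have D_nonneg: "0 \<le> D" using D(1) nonneg[of x "\<rho> g x"] by linarith
  \<comment> \<open>The signed shift of \<open>x\<close> away from \<open>p\<close>. It has to be
    bounded through \<open>D0\<close> and not \<open>D\<close>: the final estimate must not depend
    on \<open>D\<close>, which grows with the number of elements considered.\<close>
  define \<beta> where "\<beta> = d (\<rho> g x) p - d x p"
  have pq: "d p q \<le> d x p + d x q - 2 * T"
    using gp_double[of x p q] T(2) by (simp add: q_def)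
  have xy: "d x q \<le> D + d y q" "d x p \<le> D + d y p"
    using triangle[of x y q] triangle[of x y p] M gM D(2) by linarith+
  \<comment> \<open>Seen from \<open>x\<close>, the points \<open>p\<close> and \<open>q\<close>
    agree for a length \<open>T\<close>, at least \<open>2 * D\<close>, so the sum containing
    \<open>d p q\<close> does not dominate the four-point inequality. Thus \<open>x\<close> and
    \<open>y\<close> see the same difference of distances, and at \<open>y\<close> it is at most
    \<open>D0\<close>.\<close>
  have "\<bar>(d x q - d x p) - (d y q - d y p)\<bar> \<le> 2 * \<delta>"
    using four_point[of p x y q] four_point[of q x y p] M gM pq xy z(3,4) D(2) D_nonneg commute[of q p]
    unfolding max_def by (smt (verit))
  moreover have "\<bar>d y q - d y p\<bar> \<le> D0"
    using triangle[of y "\<rho> g y" p] triangle[of "\<rho> g y" y p] M gM y qy commute[of y "\<rho> g y"]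
    by linarith
  ultimately have \<beta>: "\<bar>\<beta>\<bar> \<le> D0 + 2 * \<delta>" unfolding \<beta>_def qx by linarith
  have gx: "d (\<rho> g x) p = d x p + \<beta>" "d (\<rho> g x) (\<rho> g z) = t" "d (\<rho> g x) (\<rho> g p) = d x p"
    using act_dist[OF g] M z(1) by (simp_all add: \<beta>_def)
  \<comment> \<open>The point \<open>\<rho> g z\<close> lies on a geodesic from
    \<open>\<rho> g x\<close> towards \<open>\<rho> g p\<close>, a direction shared with
    \<open>p\<close> for length \<open>t\<close>; this bounds its distance to \<open>p\<close> from
    above.\<close>
  have a1: "gp (\<rho> g x) (\<rho> g z) (\<rho> g p) = t"
    using act_gp[OF g M(1,4,3)] gp_double[of x z p] z by simp
  have a2: "t \<le> gp (\<rho> g x) (\<rho> g p) p"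
    using gp_double[of "\<rho> g x" "\<rho> g p" p] gp_double[of x p "\<rho> g p"] T(1) gx(3)
      triangle[of x "\<rho> g x" "\<rho> g p"] triangle[of x "\<rho> g x" p] M gM D(1) z(4)
      commute[of p "\<rho> g p"] by linarith
  have a3: "t - \<delta> \<le> gp (\<rho> g x) (\<rho> g z) p"
    using hyperbolic[of "\<rho> g x" "\<rho> g z" "\<rho> g p" p] a1 a2 gM M by linarith
  have gzp: "d (\<rho> g z) p \<le> d x p + \<beta> - t + 2 * \<delta>"
    using gp_double[of "\<rho> g x" "\<rho> g z" p] a3 gx by linarith
  \<comment> \<open>Seen from \<open>p\<close>, the chain \<open>z\<close>, \<open>x\<close>,
    \<open>\<rho> g x\<close>, \<open>\<rho> g z\<close> has consecutive products of almost
    \<open>d x p - t\<close>, so \<open>z\<close> and \<open>\<rho> g z\<close> are in the same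
    direction.\<close>
  have b1: "gp p z x = d x p - t"
    using gp_double[of p z x] z commute[of p z] commute[of p x] commute[of z x] by linarith
  have b2: "d x p - t - \<bar>\<beta>\<bar> \<le> gp p x (\<rho> g x)"
    using gp_double[of p x "\<rho> g x"] gx(1) D(1) z(3) D_nonneg commute[of p x]
      commute[of p "\<rho> g x"] by linarith
  have b3: "d x p - t - \<bar>\<beta>\<bar> \<le> gp p (\<rho> g x) (\<rho> g z)"
    using gp_double[of p "\<rho> g x" "\<rho> g z"] gx triangle[of "\<rho> g x" "\<rho> g z" p] M gM
      commute[of p "\<rho> g x"] commute[of p "\<rho> g z"] by linarith
  have "d x p - t - \<bar>\<beta>\<bar> - 2 * \<delta> \<le> gp p z (\<rho> g z)"
    using hyperbolic3[of p z x "\<rho> g x" "\<rho> g z"] b1 b2 b3 M gM by linarith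
  \<comment> \<open>In total at most \<open>3 * \<bar>\<beta>\<bar> + 6 * \<delta>\<close>.\<close>
  then show ?thesis
    using gp_double[of p z "\<rho> g z"] z(2) gzp \<beta> commute[of p z] commute[of p "\<rho> g z"] by linarith
qed

end
section \<open>Normal subgroups of acylindrical actions\<close>

locale acylindrical_hyperbolic_action = hyperbolic_action +
  assumes acylindrical: "acylindrical_action \<Gamma> M d \<rho>"
begin

text \<open>Passing to subsets \<open>F\<close> gives a form contradicted both by an infinite set
  and by a finite set of more than \<open>N\<close> elements.\<close>

lemma acylindricity:
  assumes "0 < \<epsilon>"
  shows "\<exists>R>0. \<exists>N::nat. \<forall>x\<in>M. \<forall>y\<in>M. \<forall>F. R \<le> d x y \<and>
    F \<subseteq> {g \<in> carrier \<Gamma>. d x (\<rho> g x) \<le> \<epsilon> \<and> d y (\<rho> g y) \<le> \<epsilon>} \<longrightarrow> finite F \<and> card F \<le> N"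
proof -
  have "\<exists>R>0. \<exists>N::nat>0. \<forall>x\<in>M. \<forall>y\<in>M. d x y \<ge> R \<longrightarrow>
      finite {g \<in> carrier \<Gamma>. d x (\<rho> g x) \<le> \<epsilon> \<and> d y (\<rho> g y) \<le> \<epsilon>} \<and>
      card {g \<in> carrier \<Gamma>. d x (\<rho> g x) \<le> \<epsilon> \<and> d y (\<rho> g y) \<le> \<epsilon>} \<le> N"
    using acylindrical assms unfolding acylindrical_action_def by (elim conjE allE impE)
  then show ?thesis
    by (meson finite_subset card_mono order_trans)
qed

text \<open>If \<open>N\<close> moved \<open>x\<close> by less than \<open>L\<close>, then by
  normality it would move every \<open>\<rho> \<gamma> x\<close> by less than \<open>L\<close> too.
  All of \<open>N\<close> would then almost fix two points that can be taken arbitrarily far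
  apart.\<close>

lemma infinite_normal_imp_unbounded:
  assumes N: "N \<lhd> \<Gamma>" "infinite N" and "limit_set \<Gamma> M d \<rho> \<noteq> {}" "x \<in> M"
  obtains a where "a \<in> N" "L \<le> d x (\<rho> a x)"
proof (rule ccontr)
  assume "\<not> thesis"
  then have small: "d x (\<rho> a x) < L" if "a \<in> N" for a using that \<open>\<And>a. \<lbrakk>a \<in> N; L \<le> d x (\<rho> a x)\<rbrakk> \<Longrightarrow> thesis\<close>
    by (meson not_le)
  have NG: "N \<subseteq> carrier \<Gamma>" using N normal_imp_subgroup subgroup.subset by blast
  define \<epsilon> where "\<epsilon> = max L 1"
  have eps: "0 < \<epsilon>" by (simp add: \<epsilon>_def)
  obtain R :: real and K :: nat where R: "0 < R" "\<forall>x\<in>M. \<forall>y\<in>M. \<forall>F. R \<le> d x y \<and>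
    F \<subseteq> {g \<in> carrier \<Gamma>. d x (\<rho> g x) \<le> \<epsilon> \<and> d y (\<rho> g y) \<le> \<epsilon>} \<longrightarrow> finite F \<and> card F \<le> K"
    using acylindricity[OF eps] by (elim exE conjE)
  obtain \<gamma> where \<gamma>: "\<gamma> \<in> carrier \<Gamma>" "R \<le> d x (\<rho> \<gamma> x)"
    using limit_set_nonempty_imp_unbounded[OF assms(3,4)] by blast
  have "d (\<rho> \<gamma> x) (\<rho> a (\<rho> \<gamma> x)) < L" if a: "a \<in> N" for a
  proof -
    have aG: "a \<in> carrier \<Gamma>" using a NG by blast
    have b: "inv \<gamma> \<otimes> a \<otimes> \<gamma> \<in> N" using normal.inv_op_closed1[OF N(1)] \<gamma> a by blast
    have "\<gamma> \<otimes> (inv \<gamma> \<otimes> a \<otimes> \<gamma>) = a \<otimes> \<gamma>" using \<gamma> aG by (simp flip: act.m_assoc)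
    then have "\<rho> \<gamma> (\<rho> (inv \<gamma> \<otimes> a \<otimes> \<gamma>) x) = \<rho> a (\<rho> \<gamma> x)"
      using act_mult \<gamma>(1) aG b NG assms(4) by (metis subsetD)
    then show ?thesis
      using act_dist[OF \<gamma>(1) assms(4), of "\<rho> (inv \<gamma> \<otimes> a \<otimes> \<gamma>) x"] small[OF b] b NG
        act_closed[OF _ assms(4)] by auto
  qed
  then have "N \<subseteq> {g \<in> carrier \<Gamma>. d x (\<rho> g x) \<le> \<epsilon> \<and> d (\<rho> \<gamma> x) (\<rho> g (\<rho> \<gamma> x)) \<le> \<epsilon>}"
    using small NG unfolding \<epsilon>_def by (fastforce simp: max_def)
  then show False
    using R(2) assms(4) act_closed[OF \<gamma>(1) assms(4)] \<gamma>(2) N(2) by blast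
qed

text \<open>Otherwise the far away points of the orbit all lie in one direction. If no element is
  loxodromic, arbitrarily many elements then move two distant points on a geodesic in that direction
  by a bounded amount.\<close>

lemma unbounded_imp_diverging_pairs:
  assumes A: "subgroup A \<Gamma>" "infinite A" and x: "x \<in> M"
    and unbounded: "\<And>L. \<exists>a\<in>A. L \<le> d x (\<rho> a x)"
  shows "diverging_pairs A x"
proof (rule ccontr)
  assume no: "\<not> diverging_pairs A x"
  have AG: "A \<subseteq> carrier \<Gamma>" using A subgroup.subset by blast
  \<comment> \<open>The threshold above which an element would be loxodromic. Neither
    \<open>D0\<close> nor \<open>\<epsilon>\<close> depends on the elements \<open>F\<close>, so
    acylindricity can fix \<open>R\<close> and \<open>K\<close> before \<open>F\<close> is
    chosen.\<close>
  define D0 where "D0 = 7 * \<delta> + 2"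
  define \<epsilon> where "\<epsilon> = 3 * D0 + 12 * \<delta>"
  have "\<exists>y\<in>M. d y (\<rho> g y) \<le> D0" if g: "g \<in> A" for g
  proof (rule ccontr)
    assume "\<not> (\<exists>y\<in>M. d y (\<rho> g y) \<le> D0)"
    then obtain y where "y \<in> M" "diverging_pairs A y"
      using large_displacement_imp_diverging_pairs[OF A(1) g] x unfolding D0_def
      by (metis empty_iff linorder_le_cases)
    then show False using diverging_pairs_change_base AG x no by blast
  qed
  then obtain y where y: "\<And>g. g \<in> A \<Longrightarrow> y g \<in> M" "\<And>g. g \<in> A \<Longrightarrow> d (y g) (\<rho> g (y g)) \<le> D0"
    by metis
  have eps: "0 < \<epsilon>" using delta_nonneg by (simp add: \<epsilon>_def D0_def)
  obtain R :: real and K :: nat where R: "0 < R" "\<forall>x\<in>M. \<forall>y\<in>M. \<forall>F. R \<le> d x y \<and>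
    F \<subseteq> {g \<in> carrier \<Gamma>. d x (\<rho> g x) \<le> \<epsilon> \<and> d y (\<rho> g y) \<le> \<epsilon>} \<longrightarrow> finite F \<and> card F \<le> K"
    using acylindricity[OF eps] by (elim exE conjE)
  obtain F where F: "F \<subseteq> A" "finite F" "card F = Suc K"
    using infinite_arbitrarily_large[OF A(2)] by metis
  define D where "D = (\<Sum>g\<in>F. d x (\<rho> g x) + d x (y g))"
  have D_ge: "d x (\<rho> g x) + d x (y g) \<le> D" if "g \<in> F" for g
    unfolding D_def using member_le_sum[of g F "\<lambda>g. d x (\<rho> g x) + d x (y g)"] that F(2) by simp
  have D_nonneg: "0 \<le> D" unfolding D_def by (simp add: sum_nonneg)
  \<comment> \<open>The test points will lie at distances \<open>D\<close> and \<open>D + R\<close>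
    from \<open>x\<close>, and \<open>almost_fixes_geodesic\<close> needs
    \<open>t + D \<le> T\<close>.\<close>
  define T where "T = 2 * D + R"
  obtain L where L: "\<And>a b. \<lbrakk>a \<in> A; b \<in> A; L \<le> d x (\<rho> a x); L \<le> d x (\<rho> b x)\<rbrakk> \<Longrightarrow>
      T \<le> gp x (\<rho> a x) (\<rho> b x)"
    using no unfolding diverging_pairs_def by (metis linorder_le_cases)
  \<comment> \<open>The margin \<open>D\<close> keeps the translates of \<open>p\<close> by
    \<open>g\<close> and \<open>inv g\<close> at distance at least \<open>L\<close>;
    \<open>R\<close> leaves room for both test points.\<close>
  obtain a where a: "a \<in> A" "max L R + D \<le> d x (\<rho> a x)" using unbounded by blast
  have aG: "a \<in> carrier \<Gamma>" using a AG by blast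
  define p where "p = \<rho> a x"
  have p: "p \<in> M" unfolding p_def using act_closed aG x by blast
  have P: "L + D \<le> d x p" "D + R \<le> d x p" using a(2) by (simp_all add: p_def)
  obtain z w where z: "z \<in> M" "d x z = D" "d z p = d x p - D"
    and w: "w \<in> M" "d x w = D + R" "d w p = d x p - (D + R)" and zw: "d z w = R"
    using geodesic_points[OF x p D_nonneg, of "D + R"] P(2) R(1)
    by (metis add_diff_cancel_left' less_add_same_cancel1 less_eq_real_def)
  have "d z (\<rho> g z) \<le> \<epsilon> \<and> d w (\<rho> g w) \<le> \<epsilon>" if gF: "g \<in> F" for g
  proof -
    have gA: "g \<in> A" using gF F(1) by blast
    then have g: "g \<in> carrier \<Gamma>" using AG by blast
    have Dg: "d x (\<rho> g x) \<le> D" "d x (y g) \<le> D"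
      using D_ge[OF gF] nonneg[of x "\<rho> g x"] nonneg[of x "y g"] by linarith+
    have M: "\<rho> g x \<in> M" "\<rho> g p \<in> M" "\<rho> (inv g) p \<in> M" using act_closed g x p by simp_all
    have "g \<otimes> a \<in> A" "inv g \<otimes> a \<in> A"
      using gA a(1) A(1) by (simp_all add: subgroup.m_closed subgroup.m_inv_closed)
    moreover have eq: "\<rho> (g \<otimes> a) x = \<rho> g p" "\<rho> (inv g \<otimes> a) x = \<rho> (inv g) p"
      using act_mult g aG x by (simp_all add: p_def)
    moreover have "L \<le> d x (\<rho> g p)"
      using triangle[of "\<rho> g x" x "\<rho> g p"] act_dist[OF g x p] M x P(1) Dg(1) commute[of x "\<rho> g x"]
      by linarith
    moreover have "L \<le> d x (\<rho> (inv g) p)"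
      using triangle[of x "\<rho> g x" p] dist_act_inv[OF g p x] M x p P(1) Dg(1)
        commute[of p "\<rho> g x"] commute[of x "\<rho> (inv g) p"] by linarith
    moreover have "L \<le> d x p" using P(1) D_nonneg by linarith
    ultimately have T: "T \<le> gp x p (\<rho> g p)" "T \<le> gp x p (\<rho> (inv g) p)"
      using L[OF a(1), of "g \<otimes> a"] L[OF a(1), of "inv g \<otimes> a"] unfolding p_def by simp_all
    show ?thesis
      using almost_fixes_geodesic[OF g x y(1)[OF gA] p z(1) Dg y(2)[OF gA] T z(2,3)]
        almost_fixes_geodesic[OF g x y(1)[OF gA] p w(1) Dg y(2)[OF gA] T w(2,3)] R(1) D_nonneg
      unfolding \<epsilon>_def T_def by simp
  qed
  then have "F \<subseteq> {g \<in> carrier \<Gamma>. d z (\<rho> g z) \<le> \<epsilon> \<and> d w (\<rho> g w) \<le> \<epsilon>}"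
    using F(1) AG by blast
  then have "card F \<le> K"
    using R(2)[rule_format, OF z(1) w(1), of F] zw by simp
  then show False using F(3) by simp
qed

lemma infinite_normal_imp_diverging_pairs:
  assumes N: "N \<lhd> \<Gamma>" "infinite N" and "limit_set \<Gamma> M d \<rho> \<noteq> {}" "x \<in> M"
  shows "diverging_pairs N x"
proof (rule unbounded_imp_diverging_pairs[OF normal_imp_subgroup[OF N(1)] N(2) assms(4)])
  show "\<exists>a\<in>N. L \<le> d x (\<rho> a x)" for L
    using infinite_normal_imp_unbounded[OF assms, of L] by blast
qed

text \<open>The orbit of the centralizer stays near a line with ends in the directions of \<open>p\<close> and \<open>q\<close>.\<close>

lemma commuting_two_directions:
  assumes N: "N \<subseteq> carrier \<Gamma>" "diverging_pairs N x" and C: "subgroup C \<Gamma>"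
    and commute_NC: "\<And>n c. \<lbrakk>n \<in> N; c \<in> C\<rbrakk> \<Longrightarrow> n \<otimes> c = c \<otimes> n" and x: "x \<in> M"
  obtains K where "\<And>E. \<lbrakk>finite E; E \<subseteq> C\<rbrakk> \<Longrightarrow> \<exists>p\<in>M. \<exists>q\<in>M. \<forall>c\<in>E.
     d x (\<rho> c x) - K \<le> gp x (\<rho> c x) p \<or> d x (\<rho> c x) - K \<le> gp x (\<rho> c x) q"
proof -
  obtain B where B: "\<And>L. \<exists>a\<in>N. \<exists>b\<in>N.
     L \<le> d x (\<rho> a x) \<and> L \<le> d x (\<rho> b x) \<and> gp x (\<rho> a x) (\<rho> b x) \<le> B"
    using N(2) unfolding diverging_pairs_def by blast
  have "\<exists>p\<in>M. \<exists>q\<in>M. \<forall>c\<in>E.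
     d x (\<rho> c x) - (B + 3 * \<delta>) \<le> gp x (\<rho> c x) p \<or> d x (\<rho> c x) - (B + 3 * \<delta>) \<le> gp x (\<rho> c x) q"
    if E: "finite E" "E \<subseteq> C" for E
  proof -
    \<comment> \<open>The pair \<open>a\<close>, \<open>b\<close> has to be far out compared with
      all displacements in \<open>E\<close>, so the directions found depend on \<open>E\<close>; the
      constant does not.\<close>
    define S where "S = (\<Sum>c\<in>E. d x (\<rho> c x))"
    obtain a b where ab: "a \<in> N" "b \<in> N" "S + B + 2 * \<delta> + 1 \<le> d x (\<rho> a x)"
      "S + B + 2 * \<delta> + 1 \<le> d x (\<rho> b x)" "gp x (\<rho> a x) (\<rho> b x) \<le> B"
      using B by blast
    have G: "a \<in> carrier \<Gamma>" "b \<in> carrier \<Gamma>" using ab N(1) by auto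
    have M: "\<rho> a x \<in> M" "\<rho> b x \<in> M" using act_closed G x by simp_all
    have "d x (\<rho> c x) - (B + 3 * \<delta>) \<le> gp x (\<rho> c x) (\<rho> a x) \<or>
      d x (\<rho> c x) - (B + 3 * \<delta>) \<le> gp x (\<rho> c x) (\<rho> b x)" if c: "c \<in> E" for c
    proof -
      have cC: "c \<in> C" "inv c \<in> C" using c E(2) C by (auto simp: subgroup.m_inv_closed)
      then have cG: "c \<in> carrier \<Gamma>" using C subgroup.subset by blast
      have cM: "\<rho> c x \<in> M" "\<rho> (inv c) x \<in> M" using act_closed cG x by simp_all
      have cdist: "d x (\<rho> (inv c) x) \<le> S"
        using dist_act_inv[OF cG x x] commute member_le_sum[of c E "\<lambda>c. d x (\<rho> c x)"] c E(1)
        unfolding S_def by simp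
      have swap: "\<rho> (inv c) (\<rho> n x) = \<rho> n (\<rho> (inv c) x)" if "n \<in> N" for n
        using commute_NC[OF that cC(2)] act_mult[of n "inv c" x] act_mult[of "inv c" n x] that N(1) cG x
        by (metis act.inv_closed subsetD)
      have near: "B + 2 * \<delta> + 1 \<le> gp x (\<rho> n x) (\<rho> n (\<rho> (inv c) x))"
        if "n \<in> N" "S + B + 2 * \<delta> + 1 \<le> d x (\<rho> n x)" for n
      proof -
        have nG: "n \<in> carrier \<Gamma>" using that N(1) by blast
        show ?thesis
          using gp_ge_dist_diff[OF x act_closed[OF nG x] act_closed[OF nG cM(2)]] act_dist[OF nG x cM(2)]
            cdist that(2) by linarith
      qed
      have "gp x (\<rho> a (\<rho> (inv c) x)) (\<rho> b (\<rho> (inv c) x)) \<le> B + 2 * \<delta>"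
        using hyperbolic3[of x "\<rho> a x" "\<rho> a (\<rho> (inv c) x)" "\<rho> b (\<rho> (inv c) x)" "\<rho> b x"]
          near[OF ab(1,3)] near[OF ab(2,4)] ab(5) x M act_closed[OF G(1) cM(2)]
          act_closed[OF G(2) cM(2)] gp_commute[of x "\<rho> b x" "\<rho> b (\<rho> (inv c) x)"]
        by linarith
      \<comment> \<open>By commutation, viewing \<open>\<rho> a x\<close> and
        \<open>\<rho> b x\<close> from \<open>\<rho> c x\<close> amounts to viewing from
        \<open>x\<close> the images of \<open>\<rho> (inv c) x\<close>. Since the pair still
        diverges there, \<open>x\<close> cannot be in both directions from
        \<open>\<rho> c x\<close>.\<close>
      then have "gp (\<rho> c x) (\<rho> a x) (\<rho> b x) \<le> B + 2 * \<delta>"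
        using gp_act_inv[OF cG x M] swap[OF ab(1)] swap[OF ab(2)] by simp
      then show ?thesis
        using hyperbolic[of "\<rho> c x" "\<rho> a x" x "\<rho> b x"] cM(1) M x
          gp_swap[of x "\<rho> c x" "\<rho> a x"] gp_swap[of x "\<rho> c x" "\<rho> b x"]
          gp_commute[of "\<rho> c x" "\<rho> a x" x] by linarith
    qed
    then show ?thesis using M by blast
  qed
  then show thesis using that by blast
qed

text \<open>An infinite \<open>C\<close> would share the full limit set and so have orbit points far
  out in three different directions, but \<open>commuting_two_directions\<close> leaves room for
  only two.\<close>

theorem commuting_normal_finite:
  assumes N: "N \<lhd> \<Gamma>" "infinite N" and C: "C \<lhd> \<Gamma>"
    and commute_NC: "\<And>n c. \<lbrakk>n \<in> N; c \<in> C\<rbrakk> \<Longrightarrow> n \<otimes> c = c \<otimes> n"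
    and inf: "infinite (limit_set \<Gamma> M d \<rho>)"
  shows "finite C"
proof (rule ccontr)
  assume infC: "infinite C"
  have ne: "limit_set \<Gamma> M d \<rho> \<noteq> {}" using inf by auto
  then obtain x where x: "x \<in> M" unfolding limit_set_def by blast
  have NG: "N \<subseteq> carrier \<Gamma>" and CG: "C \<subseteq> carrier \<Gamma>"
    using N C normal_imp_subgroup subgroup.subset by blast+
  obtain K where K: "\<And>E. \<lbrakk>finite E; E \<subseteq> C\<rbrakk> \<Longrightarrow> \<exists>p\<in>M. \<exists>q\<in>M. \<forall>c\<in>E.
     d x (\<rho> c x) - K \<le> gp x (\<rho> c x) p \<or> d x (\<rho> c x) - K \<le> gp x (\<rho> c x) q"
    using commuting_two_directions[OF NG infinite_normal_imp_diverging_pairs[OF N ne x]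
        normal_imp_subgroup[OF C] commute_NC x] by blast
  obtain F where F: "F \<subseteq> limit_set \<Gamma> M d \<rho>" "card F = 3"
    using infinite_arbitrarily_large[OF inf] by metis
  then obtain \<xi>1 \<xi>2 \<xi>3 where \<xi>: "F = {\<xi>1, \<xi>2, \<xi>3}" "\<xi>1 \<noteq> \<xi>2" "\<xi>1 \<noteq> \<xi>3" "\<xi>2 \<noteq> \<xi>3"
    by (metis card_3_iff)
  have lim: "\<xi>1 \<in> limit_set \<Gamma> M d \<rho>" "\<xi>2 \<in> limit_set \<Gamma> M d \<rho>" "\<xi>3 \<in> limit_set \<Gamma> M d \<rho>"
    using F(1) \<xi>(1) by auto
  then have bd: "\<xi>1 \<in> gromov_boundary M d" "\<xi>2 \<in> gromov_boundary M d" "\<xi>3 \<in> gromov_boundary M d"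
    unfolding limit_set_def by blast+
  note pairs = infinite_normal_imp_diverging_pairs[OF C infC ne x]
  obtain s1 where s1: "s1 \<in> \<xi>1" "range s1 \<subseteq> (\<lambda>g. \<rho> g x) ` C"
    using limit_point_in_normal_orbit[OF C pairs x lim(1)] by blast
  obtain s2 where s2: "s2 \<in> \<xi>2" "range s2 \<subseteq> (\<lambda>g. \<rho> g x) ` C"
    using limit_point_in_normal_orbit[OF C pairs x lim(2)] by blast
  obtain s3 where s3: "s3 \<in> \<xi>3" "range s3 \<subseteq> (\<lambda>g. \<rho> g x) ` C"
    using limit_point_in_normal_orbit[OF C pairs x lim(3)] by blast
  obtain B12 n12 where b12: "\<forall>i\<ge>n12. \<forall>j\<ge>n12. gp x (s1 i) (s2 j) \<le> B12"
    using distinct_boundary_points_bounded_product[OF bd(1) s1(1) bd(2) s2(1) \<xi>(2) x] by (elim exE)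
  obtain B13 n13 where b13: "\<forall>i\<ge>n13. \<forall>j\<ge>n13. gp x (s1 i) (s3 j) \<le> B13"
    using distinct_boundary_points_bounded_product[OF bd(1) s1(1) bd(3) s3(1) \<xi>(3) x] by (elim exE)
  obtain B23 n23 where b23: "\<forall>i\<ge>n23. \<forall>j\<ge>n23. gp x (s2 i) (s3 j) \<le> B23"
    using distinct_boundary_points_bounded_product[OF bd(2) s2(1) bd(3) s3(1) \<xi>(4) x] by (elim exE)
  \<comment> \<open>At this distance a loss of \<open>K\<close> still leaves a product with
    \<open>p\<close> or \<open>q\<close> more than \<open>\<delta>\<close> above all three bounds,
    so two points sharing a direction violate one of them.\<close>
  define L where "L = max B12 (max B13 B23) + K + \<delta> + 1"
  obtain m1 where m1: "\<And>i. i \<ge> m1 \<Longrightarrow> L \<le> d x (s1 i)"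
    using gromov_sequence_unbounded[OF boundary_member_sequence[OF bd(1) s1(1)] x] by blast
  obtain m2 where m2: "\<And>i. i \<ge> m2 \<Longrightarrow> L \<le> d x (s2 i)"
    using gromov_sequence_unbounded[OF boundary_member_sequence[OF bd(2) s2(1)] x] by blast
  obtain m3 where m3: "\<And>i. i \<ge> m3 \<Longrightarrow> L \<le> d x (s3 i)"
    using gromov_sequence_unbounded[OF boundary_member_sequence[OF bd(3) s3(1)] x] by blast
  define i where "i = n12 + n13 + n23 + m1 + m2 + m3"
  have ge: "n12 \<le> i" "n13 \<le> i" "n23 \<le> i" "m1 \<le> i" "m2 \<le> i" "m3 \<le> i" by (simp_all add: i_def)
  obtain c1 where c1: "c1 \<in> C" "s1 i = \<rho> c1 x" using s1(2) by auto
  obtain c2 where c2: "c2 \<in> C" "s2 i = \<rho> c2 x" using s2(2) by auto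
  obtain c3 where c3: "c3 \<in> C" "s3 i = \<rho> c3 x" using s3(2) by auto
  have M: "s1 i \<in> M" "s2 i \<in> M" "s3 i \<in> M"
    using c1 c2 c3 act_closed CG x by auto
  obtain p q where pq: "p \<in> M" "q \<in> M" "\<forall>c\<in>{c1, c2, c3}.
     d x (\<rho> c x) - K \<le> gp x (\<rho> c x) p \<or> d x (\<rho> c x) - K \<le> gp x (\<rho> c x) q"
    using K[of "{c1, c2, c3}"] c1(1) c2(1) c3(1) by auto
  define near where "near u v \<longleftrightarrow> max B12 (max B13 B23) + \<delta> + 1 \<le> gp x u v" for u v
  have "near (s1 i) p \<or> near (s1 i) q" "near (s2 i) p \<or> near (s2 i) q" "near (s3 i) p \<or> near (s3 i) q"
    using pq(3) m1[OF ge(4)] m2[OF ge(5)] m3[OF ge(6)] c1(2) c2(2) c3(2)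
    unfolding near_def L_def by fastforce+
  moreover have "max B12 (max B13 B23) < gp x u v"
    if "near u w" "near v w" "u \<in> M" "v \<in> M" "w \<in> M" for u v w
    using hyperbolic[OF x that(3,5,4)] that(1,2) gp_commute[of x v w] unfolding near_def by linarith
  ultimately show False
    using b12[rule_format, OF ge(1) ge(1)] b13[rule_format, OF ge(2) ge(2)]
      b23[rule_format, OF ge(3) ge(3)] M pq(1,2) by (smt (verit))
qed

end

lemma hyperbolic_acylindrical_actionI:
  assumes "Metric_space M d" "geodesic_space M d" "gromov_hyperbolic M d" "acylindrical_action \<Gamma> M d \<rho>"
  obtains \<delta> where "acylindrical_hyperbolic_action M d \<delta> \<Gamma> \<rho>"
proof -
  obtain \<delta> where \<delta>: "\<delta> \<ge> 0" "\<forall>p \<in> M. \<forall>x \<in> M. \<forall>y \<in> M. \<forall>z \<in> M.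
        gromov_product d p x z \<ge> min (gromov_product d p x y) (gromov_product d p y z) - \<delta>"
    using assms(3) unfolding gromov_hyperbolic_def by blast
  have "gromov_hyperbolic_space M d \<delta>"
    unfolding gromov_hyperbolic_space_def gromov_hyperbolic_space_axioms_def
    using assms(1,2) \<delta> by simp
  moreover have "isometric_action \<Gamma> M d \<rho>" using assms(4) unfolding acylindrical_action_def by blast
  ultimately have "acylindrical_hyperbolic_action M d \<delta> \<Gamma> \<rho>"
    unfolding acylindrical_hyperbolic_action_def acylindrical_hyperbolic_action_axioms_def
      hyperbolic_action_def hyperbolic_action_axioms_def
    using assms(4) by blast
  then show thesis using that by blast
qed

section \<open>Automorphisms and semidirect products\<close>

lemma (in group_hom) card_fibre_le:
  assumes "finite (kernel G H h)"
  shows "finite {g \<in> carrier G. h g = a} \<and> card {g \<in> carrier G. h g = a} \<le> card (kernel G H h)"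
proof (cases "{g \<in> carrier G. h g = a} = {}")
  case False
  then obtain k where k: "k \<in> carrier G" "h k = a" by blast
  have "{g \<in> carrier G. h g = a} \<subseteq> (\<lambda>x. k \<otimes> x) ` kernel G H h"
  proof
    fix g assume "g \<in> {g \<in> carrier G. h g = a}"
    then have g: "g \<in> carrier G" "h g = a" by auto
    have "inv k \<otimes> g \<in> kernel G H h"
      using g k H.l_inv[of a] hom_closed[of k] by (simp add: kernel_def)
    moreover have "g = k \<otimes> (inv k \<otimes> g)" using g k by (simp flip: G.m_assoc)
    ultimately show "g \<in> (\<lambda>x. k \<otimes> x) ` kernel G H h" by blast
  qed
  then show ?thesis
    using assms by (meson card_image_le card_mono finite_imageI finite_subset order_trans)
next
  case True
  then show ?thesis by (simp only: finite.emptyI card.empty) simp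
qed

lemma (in group_hom) finite_vimage_card_le:
  assumes "finite (kernel G H h)" "finite A"
  shows "finite {g \<in> carrier G. h g \<in> A} \<and>
    card {g \<in> carrier G. h g \<in> A} \<le> card A * card (kernel G H h)"
proof -
  have eq: "{g \<in> carrier G. h g \<in> A} = (\<Union>a\<in>A. {g \<in> carrier G. h g = a})" by blast
  have "card (\<Union>a\<in>A. {g \<in> carrier G. h g = a}) \<le> (\<Sum>a\<in>A. card {g \<in> carrier G. h g = a})"
    by (rule card_UN_le[OF assms(2)])
  also have "\<dots> \<le> (\<Sum>a\<in>A. card (kernel G H h))"
    by (rule sum_mono) (use card_fibre_le[OF assms(1)] in blast)
  finally show ?thesis unfolding eq using card_fibre_le[OF assms(1)] assms(2) by simp
qed

text \<open>The elements of \<open>S\<close> to be counted are the preimage of those in \<Gamma>, so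
  the bound is multiplied by the order of the kernel.\<close>

lemma acylindrical_action_pullback:
  assumes "group S" and f: "f \<in> hom S \<Gamma>" and ker: "finite (kernel S \<Gamma> f)"
    and act: "acylindrical_action \<Gamma> M d \<rho>"
  shows "acylindrical_action S M d (\<rho> \<circ> f)"
proof -
  have iso: "group_action \<Gamma> M \<rho>"
    "\<And>g x y. \<lbrakk>g \<in> carrier \<Gamma>; x \<in> M; y \<in> M\<rbrakk> \<Longrightarrow> d (\<rho> g x) (\<rho> g y) = d x y"
    using act unfolding acylindrical_action_def isometric_action_def by blast+
  then have hom: "group_hom \<Gamma> (BijGroup M) \<rho>" by (simp add: group_action_def)
  then interpret f: group_hom S \<Gamma> f
    using assms(1) f by (simp add: group_hom_def group_hom_axioms_def)
  have "\<rho> \<circ> f \<in> hom S (BijGroup M)"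
    using Group.hom_compose[OF f, of \<rho> "BijGroup M"] hom by (simp add: group_hom_def group_hom_axioms_def)
  then have isoS: "isometric_action S M d (\<rho> \<circ> f)"
    using assms(1) group_BijGroup[of M] iso(2)
    by (simp add: isometric_action_def group_action_def group_hom_def group_hom_axioms_def)
  have "\<exists>R>0. \<exists>N::nat>0. \<forall>x\<in>M. \<forall>y\<in>M. R \<le> d x y \<longrightarrow>
      finite {g \<in> carrier S. d x ((\<rho> \<circ> f) g x) \<le> \<epsilon> \<and> d y ((\<rho> \<circ> f) g y) \<le> \<epsilon>} \<and>
      card {g \<in> carrier S. d x ((\<rho> \<circ> f) g x) \<le> \<epsilon> \<and> d y ((\<rho> \<circ> f) g y) \<le> \<epsilon>} \<le> N"
    if \<epsilon>: "0 < \<epsilon>" for \<epsilon>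
  proof -
    have "\<exists>R>0. \<exists>N::nat>0. \<forall>x\<in>M. \<forall>y\<in>M. R \<le> d x y \<longrightarrow>
        finite {g \<in> carrier \<Gamma>. d x (\<rho> g x) \<le> \<epsilon> \<and> d y (\<rho> g y) \<le> \<epsilon>} \<and>
        card {g \<in> carrier \<Gamma>. d x (\<rho> g x) \<le> \<epsilon> \<and> d y (\<rho> g y) \<le> \<epsilon>} \<le> N"
      using act \<epsilon> unfolding acylindrical_action_def by (elim conjE allE impE)
    then obtain R and N :: nat where R: "0 < R" and N: "0 < N" and RN: "\<forall>x\<in>M. \<forall>y\<in>M. R \<le> d x y \<longrightarrow>
        finite {g \<in> carrier \<Gamma>. d x (\<rho> g x) \<le> \<epsilon> \<and> d y (\<rho> g y) \<le> \<epsilon>} \<and>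
        card {g \<in> carrier \<Gamma>. d x (\<rho> g x) \<le> \<epsilon> \<and> d y (\<rho> g y) \<le> \<epsilon>} \<le> N"
      by (elim exE conjE)
    have "finite {g \<in> carrier S. d x ((\<rho> \<circ> f) g x) \<le> \<epsilon> \<and> d y ((\<rho> \<circ> f) g y) \<le> \<epsilon>} \<and>
      card {g \<in> carrier S. d x ((\<rho> \<circ> f) g x) \<le> \<epsilon> \<and> d y ((\<rho> \<circ> f) g y) \<le> \<epsilon>} \<le>
        N * card (kernel S \<Gamma> f)"
      if xy: "x \<in> M" "y \<in> M" "R \<le> d x y" for x y
    proof -
      define A where "A = {g \<in> carrier \<Gamma>. d x (\<rho> g x) \<le> \<epsilon> \<and> d y (\<rho> g y) \<le> \<epsilon>}"
      have A: "finite A" "card A \<le> N" using RN xy unfolding A_def by blast+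
      have eq: "{g \<in> carrier S. d x ((\<rho> \<circ> f) g x) \<le> \<epsilon> \<and> d y ((\<rho> \<circ> f) g y) \<le> \<epsilon>} =
          {g \<in> carrier S. f g \<in> A}"
        unfolding A_def using f.hom_closed by auto
      show ?thesis
        unfolding eq using f.finite_vimage_card_le[OF ker A(1)] mult_le_mono1[OF A(2)] order_trans
        by blast
    qed
    moreover have "\<one>\<^bsub>S\<^esub> \<in> kernel S \<Gamma> f" by (simp add: kernel_def)
    then have "0 < N * card (kernel S \<Gamma> f)" using N ker by (auto simp: card_gt_0_iff)
    ultimately show ?thesis using R by blast
  qed
  then show ?thesis using isoS unfolding acylindrical_action_def by blast
qed

section \<open>Inner automorphisms\<close>

context group
begin

lemma AutoGroup_mult:
  "\<lbrakk>\<alpha> \<in> carrier (AutoGroup G); \<beta> \<in> carrier (AutoGroup G); x \<in> carrier G\<rbrakk>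
    \<Longrightarrow> (\<alpha> \<otimes>\<^bsub>AutoGroup G\<^esub> \<beta>) x = \<alpha> (\<beta> x)"
  by (simp add: AutoGroup_def BijGroup_def auto_def compose_def)

lemma AutoGroup_one: "x \<in> carrier G \<Longrightarrow> \<one>\<^bsub>AutoGroup G\<^esub> x = x"
  by (simp add: AutoGroup_def BijGroup_def)

lemma AutoGroup_hom: "\<alpha> \<in> carrier (AutoGroup G) \<Longrightarrow> \<alpha> \<in> hom G G"
  by (simp add: AutoGroup_def auto_def)

lemma AutoGroup_closed: "\<lbrakk>\<alpha> \<in> carrier (AutoGroup G); x \<in> carrier G\<rbrakk> \<Longrightarrow> \<alpha> x \<in> carrier G"
  using AutoGroup_hom hom_in_carrier by metis

lemma AutoGroup_eqI:
  assumes "\<alpha> \<in> carrier (AutoGroup G)" "\<beta> \<in> carrier (AutoGroup G)" "\<And>x. x \<in> carrier G \<Longrightarrow> \<alpha> x = \<beta> x"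
  shows "\<alpha> = \<beta>"
proof (rule extensionalityI)
  show "\<alpha> \<in> extensional (carrier G)" "\<beta> \<in> extensional (carrier G)"
    using assms by (auto simp: AutoGroup_def auto_def Bij_def)
qed (use assms in blast)

lemma inner_aut_apply: "x \<in> carrier G \<Longrightarrow> inner_aut G g x = g \<otimes> x \<otimes> inv g"
  by (simp add: inner_aut_def)

lemma inner_aut_inverse:
  "\<lbrakk>g \<in> carrier G; x \<in> carrier G\<rbrakk> \<Longrightarrow> inner_aut G (inv g) (inner_aut G g x) = x"
  by (simp add: inner_aut_apply m_assoc inv_mult_group) (simp flip: m_assoc)

lemma inner_aut_closed:
  assumes g: "g \<in> carrier G"
  shows "inner_aut G g \<in> carrier (AutoGroup G)"
proof -
  have maps: "inner_aut G k \<in> carrier G \<rightarrow> carrier G" if "k \<in> carrier G" for k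
    using that by (simp add: inner_aut_apply)
  have "bij_betw (inner_aut G g) (carrier G) (carrier G)"
    by (rule bij_betwI[where g = "inner_aut G (inv g)"])
      (use maps g inner_aut_inverse[of "inv g"] inner_aut_inverse[OF g] in simp_all)
  moreover have "inner_aut G g (x \<otimes> y) = inner_aut G g x \<otimes> inner_aut G g y"
    if "x \<in> carrier G" "y \<in> carrier G" for x y
  proof -
    have "g \<otimes> x \<otimes> inv g \<otimes> (g \<otimes> y \<otimes> inv g) = g \<otimes> x \<otimes> (inv g \<otimes> g) \<otimes> y \<otimes> inv g"
      using that g by (simp only: m_assoc m_closed inv_closed)
    then show ?thesis using that g by (simp add: inner_aut_apply m_assoc)
  qed
  ultimately show ?thesis
    using maps[OF g] by (simp add: AutoGroup_def auto_def Bij_def hom_def inner_aut_def)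
qed

lemma inner_aut_hom: "inner_aut G \<in> hom G (AutoGroup G)"
proof (rule homI)
  fix g h assume gh: "g \<in> carrier G" "h \<in> carrier G"
  interpret A: group "AutoGroup G" by (rule AutoGroup)
  show "inner_aut G (g \<otimes> h) = inner_aut G g \<otimes>\<^bsub>AutoGroup G\<^esub> inner_aut G h"
  proof (rule AutoGroup_eqI)
    fix x assume "x \<in> carrier G"
    then show "inner_aut G (g \<otimes> h) x = (inner_aut G g \<otimes>\<^bsub>AutoGroup G\<^esub> inner_aut G h) x"
      using gh by (simp add: AutoGroup_mult inner_aut_closed inner_aut_apply inv_mult_group m_assoc)
  qed (use gh inner_aut_closed in auto)
qed (rule inner_aut_closed)

text \<open>The conjugation formula, free of inverses in Aut(G): it gives both the normality of
  \<open>Inn G\<close> and the multiplicativity of \<open>conj_action\<close>.\<close>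

lemma aut_inner_aut:
  assumes \<alpha>: "\<alpha> \<in> carrier (AutoGroup G)" and g: "g \<in> carrier G"
  shows "\<alpha> \<otimes>\<^bsub>AutoGroup G\<^esub> inner_aut G g = inner_aut G (\<alpha> g) \<otimes>\<^bsub>AutoGroup G\<^esub> \<alpha>"
proof -
  interpret A: group "AutoGroup G" by (rule AutoGroup)
  interpret \<alpha>: group_hom G G \<alpha>
    using AutoGroup_hom[OF \<alpha>] by (simp add: group_hom_def group_hom_axioms_def is_group)
  show ?thesis
  proof (rule AutoGroup_eqI)
    fix x assume "x \<in> carrier G"
    then show "(\<alpha> \<otimes>\<^bsub>AutoGroup G\<^esub> inner_aut G g) x = (inner_aut G (\<alpha> g) \<otimes>\<^bsub>AutoGroup G\<^esub> \<alpha>) x"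
      using \<alpha> g by (simp add: AutoGroup_mult inner_aut_closed inner_aut_apply)
  qed (use \<alpha> g inner_aut_closed in auto)
qed

lemma inner_aut_group_hom: "group_hom G (AutoGroup G) (inner_aut G)"
  using inner_aut_hom AutoGroup by (simp add: group_hom_def group_hom_axioms_def is_group)

lemma Inn_normal: "Inn G \<lhd> AutoGroup G"
proof -
  interpret A: group "AutoGroup G" by (rule AutoGroup)
  have "subgroup (Inn G) (AutoGroup G)"
    unfolding Inn_def using group_hom.subgroup_img_is_subgroup[OF inner_aut_group_hom subgroup_self] .
  moreover have "\<alpha> \<otimes>\<^bsub>AutoGroup G\<^esub> \<beta> \<otimes>\<^bsub>AutoGroup G\<^esub> inv\<^bsub>AutoGroup G\<^esub> \<alpha> \<in> Inn G"
    if \<alpha>: "\<alpha> \<in> carrier (AutoGroup G)" and \<beta>: "\<beta> \<in> Inn G" for \<alpha> \<beta>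
  proof -
    obtain g where g: "g \<in> carrier G" "\<beta> = inner_aut G g" using \<beta> by (auto simp: Inn_def)
    have "\<alpha> \<otimes>\<^bsub>AutoGroup G\<^esub> \<beta> \<otimes>\<^bsub>AutoGroup G\<^esub> inv\<^bsub>AutoGroup G\<^esub> \<alpha> = inner_aut G (\<alpha> g)"
      using \<alpha> g AutoGroup_closed inner_aut_closed by (simp add: aut_inner_aut A.m_assoc)
    then show ?thesis using AutoGroup_closed \<alpha> g(1) by (simp add: Inn_def)
  qed
  ultimately show ?thesis using A.normal_inv_iff by blast
qed

lemma kernel_inner_aut: "kernel G (AutoGroup G) (inner_aut G) = group_center G"
proof -
  interpret A: group "AutoGroup G" by (rule AutoGroup)
  have "inner_aut G g = \<one>\<^bsub>AutoGroup G\<^esub> \<longleftrightarrow> (\<forall>x\<in>carrier G. g \<otimes> x = x \<otimes> g)"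
    if g: "g \<in> carrier G" for g
  proof -
    have "inner_aut G g = \<one>\<^bsub>AutoGroup G\<^esub> \<longleftrightarrow> (\<forall>x\<in>carrier G. g \<otimes> x \<otimes> inv g = x)"
      using AutoGroup_eqI[OF inner_aut_closed[OF g] A.one_closed]
      by (metis AutoGroup_one inner_aut_apply)
    also have "\<dots> \<longleftrightarrow> (\<forall>x\<in>carrier G. g \<otimes> x = x \<otimes> g)"
      using g by (metis inv_solve_right m_closed)
    finally show ?thesis .
  qed
  then show ?thesis unfolding kernel_def group_center_def by blast
qed

text \<open>Automorphisms are extensional, so those of a finite carrier form a subset of a finite
  function space.\<close>

lemma infinite_AutoGroup_imp_infinite:
  assumes "infinite (carrier (AutoGroup G))"
  shows "infinite (carrier G)"
proof
  assume "finite (carrier G)"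
  then have "finite (carrier G \<rightarrow>\<^sub>E carrier G)" by (simp add: finite_PiE)
  moreover have "carrier (AutoGroup G) \<subseteq> carrier G \<rightarrow>\<^sub>E carrier G"
    using AutoGroup_closed by (auto simp: AutoGroup_def auto_def Bij_def PiE_def hom_def)
  ultimately show False using assms finite_subset by blast
qed

lemma infinite_Inn:
  assumes "infinite (carrier G)" "finite (group_center G)"
  shows "infinite (Inn G)"
proof
  assume fin: "finite (Inn G)"
  have "carrier G = {g \<in> carrier G. inner_aut G g \<in> Inn G}" by (auto simp: Inn_def)
  then show False
    using group_hom.finite_vimage_card_le[OF inner_aut_group_hom _ fin] assms
    by (simp add: kernel_inner_aut)
qed

end

section \<open>The semidirect product and its conjugation action\<close>

locale semidirect = G: group G + H: group H
  for G :: "('a, 'm) monoid_scheme" (structure) and H :: "('b, 'n) monoid_scheme" (structure) +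
  fixes \<phi> :: "'b \<Rightarrow> 'a \<Rightarrow> 'a"
  assumes \<phi>: "\<phi> \<in> hom H (AutoGroup G)"
begin

abbreviation S :: "('a \<times> 'b) monoid" where "S \<equiv> semidirect_product G H \<phi>"

abbreviation K :: "'b set" where "K \<equiv> kernel H (OutGroup G) (to_Out G \<circ> \<phi>)"

sublocale A: group "AutoGroup G" by (rule G.AutoGroup)

sublocale \<phi>: group_hom H "AutoGroup G" \<phi>
  using \<phi> by unfold_locales

lemma carrier_S: "(g, h) \<in> carrier S \<longleftrightarrow> g \<in> carrier G \<and> h \<in> carrier H"
  by (simp add: semidirect_product_def)

lemma mult_S: "(g, h) \<otimes>\<^bsub>S\<^esub> (g', h') = (g \<otimes> \<phi> h g', h \<otimes>\<^bsub>H\<^esub> h')"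
  by (simp add: semidirect_product_def)

lemma one_S: "\<one>\<^bsub>S\<^esub> = (\<one>, \<one>\<^bsub>H\<^esub>)"
  by (simp add: semidirect_product_def)

lemma phi_closed: "\<lbrakk>h \<in> carrier H; g \<in> carrier G\<rbrakk> \<Longrightarrow> \<phi> h g \<in> carrier G"
  using G.AutoGroup_closed \<phi>.hom_closed by blast

lemma phi_mult:
  "\<lbrakk>h \<in> carrier H; g \<in> carrier G; g' \<in> carrier G\<rbrakk> \<Longrightarrow> \<phi> h (g \<otimes> g') = \<phi> h g \<otimes> \<phi> h g'"
  using G.AutoGroup_hom[OF \<phi>.hom_closed] by (simp add: hom_def)

lemma phi_apply_one: "h \<in> carrier H \<Longrightarrow> \<phi> h \<one> = \<one>"
  using phi_mult[of h \<one> \<one>] phi_closed[of h \<one>] G.l_cancel_one by force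

lemma group_S: "group S"
proof (rule groupI)
  fix x assume "x \<in> carrier S"
  then obtain g h where x: "x = (g, h)" "g \<in> carrier G" "h \<in> carrier H"
    by (cases x) (simp add: carrier_S)
  define y where "y = (\<phi> (inv\<^bsub>H\<^esub> h) (inv g), inv\<^bsub>H\<^esub> h)"
  have "y \<otimes>\<^bsub>S\<^esub> x = \<one>\<^bsub>S\<^esub>"
    using x phi_mult[of "inv\<^bsub>H\<^esub> h" "inv g" g, symmetric]
    by (simp add: y_def mult_S one_S phi_apply_one del: \<phi>.hom_inv)
  moreover have "y \<in> carrier S" using x by (simp add: y_def carrier_S phi_closed del: \<phi>.hom_inv)
  ultimately show "\<exists>y\<in>carrier S. y \<otimes>\<^bsub>S\<^esub> x = \<one>\<^bsub>S\<^esub>" by blast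
qed (auto simp: carrier_S mult_S one_S phi_closed phi_mult G.AutoGroup_mult G.AutoGroup_one G.m_assoc H.m_assoc)

sublocale S: group S by (rule group_S)

text \<open>Conjugation in \<open>S\<close> restricted to the normal factor \<open>G\<close>: it
  takes \<open>x\<close> to \<open>g \<otimes> \<phi> h x \<otimes> inv g\<close>.\<close>

definition conj_action :: "'a \<times> 'b \<Rightarrow> 'a \<Rightarrow> 'a" where
  "conj_action = (\<lambda>(g, h). inner_aut G g \<otimes>\<^bsub>AutoGroup G\<^esub> \<phi> h)"

lemma conj_action_hom: "conj_action \<in> hom S (AutoGroup G)"
proof (rule homI)
  fix x y assume xy: "x \<in> carrier S" "y \<in> carrier S"
  obtain g h where x: "x = (g, h)" "g \<in> carrier G" "h \<in> carrier H"
    using xy by (cases x) (simp add: carrier_S)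
  obtain g' h' where y: "y = (g', h')" "g' \<in> carrier G" "h' \<in> carrier H"
    using xy by (cases y) (simp add: carrier_S)
  have "conj_action (x \<otimes>\<^bsub>S\<^esub> y) =
      inner_aut G g \<otimes>\<^bsub>AutoGroup G\<^esub> (inner_aut G (\<phi> h g') \<otimes>\<^bsub>AutoGroup G\<^esub> \<phi> h) \<otimes>\<^bsub>AutoGroup G\<^esub> \<phi> h'"
    using x y by (simp add: conj_action_def mult_S phi_closed G.inner_aut_closed A.m_assoc
        hom_mult[OF G.inner_aut_hom])
  also have "inner_aut G (\<phi> h g') \<otimes>\<^bsub>AutoGroup G\<^esub> \<phi> h = \<phi> h \<otimes>\<^bsub>AutoGroup G\<^esub> inner_aut G g'"
    using G.aut_inner_aut x y by simp
  finally show "conj_action (x \<otimes>\<^bsub>S\<^esub> y) = conj_action x \<otimes>\<^bsub>AutoGroup G\<^esub> conj_action y"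
    using x y by (simp add: conj_action_def G.inner_aut_closed A.m_assoc)
qed (auto simp: conj_action_def carrier_S G.inner_aut_closed)

sublocale \<Psi>: group_hom S "AutoGroup G" conj_action
  using conj_action_hom by unfold_locales

lemma conj_action_G: "g \<in> carrier G \<Longrightarrow> conj_action (g, \<one>\<^bsub>H\<^esub>) = inner_aut G g"
  by (simp add: conj_action_def G.inner_aut_closed)

lemma K_eq: "K = {h \<in> carrier H. \<phi> h \<in> Inn G}"
proof -
  have sub: "subgroup (Inn G) (AutoGroup G)" using G.Inn_normal normal_imp_subgroup by blast
  have "to_Out G (\<phi> h) = Inn G \<longleftrightarrow> \<phi> h \<in> Inn G" if "h \<in> carrier H" for h
    unfolding to_Out_def
    using A.coset_join1[OF _ \<phi>.hom_closed[OF that] sub] A.coset_join2[OF \<phi>.hom_closed[OF that] sub]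
    by (rule iffI)
  then show ?thesis by (auto simp: kernel_def OutGroup_def FactGroup_def)
qed

lemma subgroup_K: "subgroup K H"
proof -
  have "to_Out G \<in> hom (AutoGroup G) (OutGroup G)"
    using normal.r_coset_hom_Mod[OF G.Inn_normal] unfolding OutGroup_def to_Out_def .
  then have "to_Out G \<circ> \<phi> \<in> hom H (OutGroup G)" using hom_compose[OF \<phi>] by blast
  moreover have "group (OutGroup G)"
    unfolding OutGroup_def by (rule normal.factorgroup_is_group[OF G.Inn_normal])
  ultimately show ?thesis
    by (intro group_hom.subgroup_kernel) (simp add: group_hom_def group_hom_axioms_def H.is_group)
qed

text \<open>An element \<open>(g, h)\<close> is in the kernel when \<open>inner_aut G g\<close>
  cancels \<open>\<phi> h\<close>, and some \<open>g\<close> does so exactly when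
  \<open>\<phi> h\<close> is inner.\<close>

lemma K_eq_snd_kernel: "K = snd ` kernel S (AutoGroup G) conj_action"
proof
  show "K \<subseteq> snd ` kernel S (AutoGroup G) conj_action"
  proof
    fix h assume "h \<in> K"
    then obtain g where h: "h \<in> carrier H" "g \<in> carrier G" "\<phi> h = inner_aut G g"
      by (auto simp: K_eq Inn_def)
    have "conj_action (inv g, h) = \<one>\<^bsub>AutoGroup G\<^esub>"
      using h hom_mult[OF G.inner_aut_hom, of "inv g" g] G.inner_aut_group_hom
      by (simp add: conj_action_def group_hom.hom_one)
    then have "(inv g, h) \<in> kernel S (AutoGroup G) conj_action"
      using h by (simp add: kernel_def carrier_S)
    then show "h \<in> snd ` kernel S (AutoGroup G) conj_action" by force
  qed
  show "snd ` kernel S (AutoGroup G) conj_action \<subseteq> K"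
  proof
    fix h assume "h \<in> snd ` kernel S (AutoGroup G) conj_action"
    then obtain g where g: "g \<in> carrier G" "h \<in> carrier H"
      "inner_aut G g \<otimes>\<^bsub>AutoGroup G\<^esub> \<phi> h = \<one>\<^bsub>AutoGroup G\<^esub>"
      by (auto simp: kernel_def carrier_S conj_action_def)
    then have "\<phi> h = inv\<^bsub>AutoGroup G\<^esub> (inner_aut G g)"
      using A.inv_equality A.inv_inv G.inner_aut_closed \<phi>.hom_closed by metis
    also have "\<dots> = inner_aut G (inv g)"
      using group_hom.hom_inv[OF G.inner_aut_group_hom g(1)] by simp
    finally show "h \<in> K" using g by (simp add: K_eq Inn_def)
  qed
qed

text \<open>Over each \<open>h\<close> in \<open>K\<close> the kernel is a fibre of
  \<open>inner_aut G\<close>, hence a coset of the center.\<close>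

lemma finite_kernel_conj_action:
  assumes "finite K" "finite (group_center G)"
  shows "finite (kernel S (AutoGroup G) conj_action)"
proof -
  have "kernel S (AutoGroup G) conj_action \<subseteq>
      (\<Union>h\<in>K. {g \<in> carrier G. inner_aut G g = inv\<^bsub>AutoGroup G\<^esub> (\<phi> h)} \<times> {h})"
  proof
    fix x assume x: "x \<in> kernel S (AutoGroup G) conj_action"
    obtain g h where gh: "x = (g, h)" by (cases x)
    then have "h \<in> K" unfolding K_eq_snd_kernel using x by force
    moreover have "inner_aut G g \<otimes>\<^bsub>AutoGroup G\<^esub> \<phi> h = \<one>\<^bsub>AutoGroup G\<^esub>" "g \<in> carrier G" "h \<in> carrier H"
      using x gh by (auto simp: kernel_def carrier_S conj_action_def)
    then have "inner_aut G g = inv\<^bsub>AutoGroup G\<^esub> (\<phi> h)" "g \<in> carrier G"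
      using A.inv_equality G.inner_aut_closed \<phi>.hom_closed by auto
    ultimately show "x \<in> (\<Union>h\<in>K. {g \<in> carrier G. inner_aut G g = inv\<^bsub>AutoGroup G\<^esub> (\<phi> h)} \<times> {h})"
      using gh by blast
  qed
  moreover have "finite {g \<in> carrier G. inner_aut G g = \<alpha>}" for \<alpha>
    using group_hom.card_fibre_le[OF G.inner_aut_group_hom] assms(2) by (simp add: G.kernel_inner_aut)
  ultimately show ?thesis using assms(1) by (meson finite.emptyI finite.insertI finite_SigmaI finite_UN_I finite_subset)
qed

lemma G_factor_normal: "carrier G \<times> {\<one>\<^bsub>H\<^esub>} \<lhd> S"
proof -
  have "group_hom S H snd"
    by (unfold_locales, rule homI) (auto simp: carrier_S mult_S)
  moreover have "kernel S H snd = carrier G \<times> {\<one>\<^bsub>H\<^esub>}"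
    by (auto simp: kernel_def carrier_S)
  ultimately show ?thesis using group_hom.normal_kernel by metis
qed

lemma G_factor_commutes_with_kernel:
  assumes "n \<in> carrier G \<times> {\<one>\<^bsub>H\<^esub>}" "c \<in> kernel S (AutoGroup G) conj_action"
  shows "n \<otimes>\<^bsub>S\<^esub> c = c \<otimes>\<^bsub>S\<^esub> n"
proof -
  obtain x g h where n: "n = (x, \<one>\<^bsub>H\<^esub>)" "x \<in> carrier G" and c: "c = (g, h)"
    using assms(1) by (cases c) auto
  then have gh: "g \<in> carrier G" "h \<in> carrier H"
    and k: "inner_aut G g \<otimes>\<^bsub>AutoGroup G\<^esub> \<phi> h = \<one>\<^bsub>AutoGroup G\<^esub>"
    using assms(2) by (auto simp: kernel_def carrier_S conj_action_def)
  have "inner_aut G g (\<phi> h x) = x"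
    using k G.AutoGroup_mult[OF G.inner_aut_closed[OF gh(1)] \<phi>.hom_closed[OF gh(2)] n(2)]
      G.AutoGroup_one[OF n(2)] by simp
  then have "g \<otimes> \<phi> h x = x \<otimes> g"
    using gh n(2) phi_closed by (metis G.inner_aut_apply G.inv_solve_right G.m_closed)
  then show ?thesis using n c gh by (simp add: mult_S G.AutoGroup_one)
qed

end

section \<open>Finiteness of the kernel and acylindrical hyperbolicity of the product\<close>

theorem theorem1p5:
  fixes G :: "('a, 'm) monoid_scheme" and H :: "('b, 'n) monoid_scheme"
    and \<phi> :: "'b \<Rightarrow> 'a \<Rightarrow> 'a"
  assumes "group G" and "finite (group_center G)"
    and "acylindrically_hyperbolic TYPE('x) (AutoGroup G)"
    and "group H" and "\<phi> \<in> hom H (AutoGroup G)"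
  defines "K \<equiv> kernel H (OutGroup G) (to_Out G \<circ> \<phi>)"
  shows "acylindrically_hyperbolic TYPE('x) (semidirect_product G H \<phi>) \<longleftrightarrow>
           subgroup K H \<and> finite K"
proof -
  interpret P: semidirect G H \<phi>
    using assms(1,4,5) by (simp add: semidirect_def semidirect_axioms_def)
  let ?C = "kernel P.S (AutoGroup G) P.conj_action"
  obtain M :: "'x set" and d \<rho> where X: "Metric_space M d" "geodesic_space M d" "gromov_hyperbolic M d"
    "acylindrical_action (AutoGroup G) M d \<rho>" and inf: "infinite (limit_set (AutoGroup G) M d \<rho>)"
    using assms(3) unfolding acylindrically_hyperbolic_def non_elementary_action_def
    by (elim conjE exE)
  obtain \<delta> where "acylindrical_hyperbolic_action M d \<delta> (AutoGroup G) \<rho>"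
    using hyperbolic_acylindrical_actionI[OF X] .
  then interpret X: acylindrical_hyperbolic_action M d \<delta> "AutoGroup G" \<rho> .
  have ne: "limit_set (AutoGroup G) M d \<rho> \<noteq> {}" using inf by auto
  have infG: "infinite (carrier G)"
    using P.G.infinite_AutoGroup_imp_infinite X.limit_set_nonempty_imp_infinite[OF ne] by blast
  show ?thesis
  proof
    assume "acylindrically_hyperbolic TYPE('x) P.S"
    then obtain M' :: "'x set" and d' \<rho>' where
      Y: "Metric_space M' d'" "geodesic_space M' d'" "gromov_hyperbolic M' d'"
        "acylindrical_action P.S M' d' \<rho>'" and infY: "infinite (limit_set P.S M' d' \<rho>')"
      unfolding acylindrically_hyperbolic_def non_elementary_action_def
      by (elim conjE exE)
    obtain \<delta>' where "acylindrical_hyperbolic_action M' d' \<delta>' P.S \<rho>'"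
      using hyperbolic_acylindrical_actionI[OF Y] .
    then interpret Y: acylindrical_hyperbolic_action M' d' \<delta>' P.S \<rho>' .
    have "infinite (carrier G \<times> {\<one>\<^bsub>H\<^esub>})" using infG by (auto dest: finite_cartesian_productD1)
    \<comment> \<open>The factor \<open>G\<close> plays the infinite normal subgroup and the kernel
      of \<open>conj_action\<close> its commuting partner.\<close>
    then have "finite ?C"
      by (rule Y.commuting_normal_finite[OF P.G_factor_normal _ P.\<Psi>.normal_kernel
            P.G_factor_commutes_with_kernel infY])
    then show "subgroup K H \<and> finite K"
      unfolding K_def using P.subgroup_K P.K_eq_snd_kernel by simp
  next
    assume "subgroup K H \<and> finite K"
    then have "finite ?C" using P.finite_kernel_conj_action assms(2) unfolding K_def by blast
    then have acyl: "acylindrical_action P.S M d (\<rho> \<circ> P.conj_action)"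
      using acylindrical_action_pullback[OF P.group_S P.conj_action_hom _ X(4)] by blast
    obtain x where x: "x \<in> M" using ne unfolding limit_set_def by blast
    have pairs: "X.diverging_pairs (Inn G) x"
      using X.infinite_normal_imp_diverging_pairs[OF P.G.Inn_normal _ ne x]
        P.G.infinite_Inn[OF infG assms(2)] by blast
    have orb: "(\<lambda>\<alpha>. \<rho> \<alpha> x) ` Inn G \<subseteq> orbit P.S (\<rho> \<circ> P.conj_action) x"
    proof
      fix y assume "y \<in> (\<lambda>\<alpha>. \<rho> \<alpha> x) ` Inn G"
      then obtain g where g: "g \<in> carrier G" "y = \<rho> (inner_aut G g) x" by (auto simp: Inn_def)
      then have "y = (\<rho> \<circ> P.conj_action) (g, \<one>\<^bsub>H\<^esub>) x" by (simp add: P.conj_action_G)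
      moreover have "(g, \<one>\<^bsub>H\<^esub>) \<in> carrier P.S" using g(1) by (simp add: P.carrier_S)
      ultimately show "y \<in> orbit P.S (\<rho> \<circ> P.conj_action) x" unfolding orbit_def by blast
    qed
    \<comment> \<open>The image of \<open>S\<close> may be much smaller than Aut(G), but each limit
      point is already approached by the orbit of \<open>Inn G\<close>, which the image
      contains.\<close>
    have "limit_set (AutoGroup G) M d \<rho> \<subseteq> limit_set P.S M d (\<rho> \<circ> P.conj_action)"
    proof
      fix \<xi> assume \<xi>: "\<xi> \<in> limit_set (AutoGroup G) M d \<rho>"
      obtain t where "t \<in> \<xi>" "range t \<subseteq> (\<lambda>\<alpha>. \<rho> \<alpha> x) ` Inn G"
        using X.limit_point_in_normal_orbit[OF P.G.Inn_normal pairs x \<xi>] by blast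
      moreover have "\<xi> \<in> gromov_boundary M d" using \<xi> unfolding limit_set_def by blast
      ultimately show "\<xi> \<in> limit_set P.S M d (\<rho> \<circ> P.conj_action)"
        using orb x unfolding limit_set_def by blast
    qed
    then have "non_elementary_action P.S M d (\<rho> \<circ> P.conj_action)"
      using inf finite_subset unfolding non_elementary_action_def by blast
    then show "acylindrically_hyperbolic TYPE('x) P.S"
      using X(1-3) acyl P.group_S unfolding acylindrically_hyperbolic_def by blast
  qed
qed

end
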